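(* Let $\mathcal M: z=z(u,v)$, $(u,v)\in\mathcal D$, be a diagonalizable time-like Weingarten surface in the Minkowski space $\mathbb R^3_1$. Then $\mathcal M$ admits locally (i.e. in a neighborhood of each of its points) natural principal parameters.
   Context: $\mathbb R^3_1$ is $\mathbb R^3$ with the flat metric $\langle x,y\rangle=x_1y_1+x_2y_2-x_3y_3$. All functions are assumed sufficiently smooth. For a time-like surface $z=z(u,v)$ let $l$ be the unit normal field, $\langle l,l\rangle=1$, and $E=\langle z_u,z_u\rangle$, $F=\langle z_u,z_v\rangle$, $G=\langle z_v,z_v\rangle$, $L=\langle l,z_{uu}\rangle$, $M=\langle l,z_{uv}\rangle$, $N=\langle l,z_{vv}\rangle$, with $E<0$, $G>0$. The linear Weingarten map $\gamma$ is defined by $\gamma(z_u)=l_u$, $\gamma(z_v)=l_v$; $H=-\frac12\mathrm{tr}\,\gamma$, $K=\det\gamma$. Throughout, time-like surfaces are assumed diagonalizable without umbilical points: $H^2-K>0$. Such a surface can be locally parameterized by principal parameters, i.e. $F=M=0$; then the principal curvatures are $\nu_1=L/E$, $\nu_2=N/G$ (so $\nu_1\neq\nu_2$). The surface is a Weingarten surface (W-surface) if there are differentiable functions $f(\nu),g(\nu)$, $\nu\in\mathcal I\subseteq\mathbb R$ ($\mathcal I$ an interval), with $f(\nu)-g(\nu)\ne0$, $f'(\nu)g'(\nu)\neq0$, and a function $\nu=\nu(u,v)$ such that $\nu_1=f(\nu)$, $\nu_2=g(\nu)$ at every point. Principal parameters $(u,v)$ on a Weingarten surface are called natural principal parameters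 if both functions $\lambda=\sqrt{-E}\,\exp\left(\int\frac{f'd\nu}{f-g}\right)$ and $\mu=\sqrt G\,\exp\left(\int\frac{g'd\nu}{g-f}\right)$ (antiderivatives in $\nu$, evaluated at $\nu=\nu(u,v)$) are constant. *)

theory Defs
  imports "HOL-Analysis.Analysis"
begin

text \<open>Derivatives are taken within the set, so that the definition also applies to intervals with
  end points. On the sets where it is used (open sets and non-degenerate intervals) the derivative
  within the set is unique. As the domain is finite-dimensional, it is enough to
  ask for regularity of all directional derivatives.\<close>

fun Ck_on :: "nat \<Rightarrow> ('a::euclidean_space \<Rightarrow> 'b::real_normed_vector) \<Rightarrow> 'a set \<Rightarrow> bool" where
  "Ck_on 0 h S \<longleftrightarrow> continuous_on S h"
| "Ck_on (Suc k) h S \<longleftrightarrow>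
     (\<exists>h'. (\<forall>x\<in>S. (h has_derivative h' x) (at x within S)) \<and> (\<forall>w. Ck_on k (\<lambda>x. h' x w) S))"

definition smooth_on :: "('a::euclidean_space \<Rightarrow> 'b::real_normed_vector) \<Rightarrow> 'a set \<Rightarrow> bool" where
  "smooth_on h S \<longleftrightarrow> (\<forall>k. Ck_on k h S)"

definition smooth_diffeo ::
    "('a::euclidean_space) set \<Rightarrow> ('b::euclidean_space) set \<Rightarrow> ('a \<Rightarrow> 'b) \<Rightarrow> ('b \<Rightarrow> 'a) \<Rightarrow> bool" where
  "smooth_diffeo V U \<phi> \<psi> \<longleftrightarrow>
     open V \<and> open U \<and> homeomorphism V U \<phi> \<psi> \<and> smooth_on \<phi> V \<and> smooth_on \<psi> U"

definition mink :: "real^3 \<Rightarrow> real^3 \<Rightarrow> real" where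
  "mink x y = x$1 * y$1 + x$2 * y$2 - x$3 * y$3"

definition pd_u :: "(real \<times> real \<Rightarrow> 'b::real_normed_vector) \<Rightarrow> real \<times> real \<Rightarrow> 'b" where
  "pd_u h p = vector_derivative (\<lambda>s. h (s, snd p)) (at (fst p))"

definition pd_v :: "(real \<times> real \<Rightarrow> 'b::real_normed_vector) \<Rightarrow> real \<times> real \<Rightarrow> 'b" where
  "pd_v h p = vector_derivative (\<lambda>t. h (fst p, t)) (at (snd p))"

definition coeff_E :: "(real \<times> real \<Rightarrow> real^3) \<Rightarrow> real \<times> real \<Rightarrow> real" where
  "coeff_E z p = mink (pd_u z p) (pd_u z p)"

definition coeff_F :: "(real \<times> real \<Rightarrow> real^3) \<Rightarrow> real \<times> real \<Rightarrow> real" where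
  "coeff_F z p = mink (pd_u z p) (pd_v z p)"

definition coeff_G :: "(real \<times> real \<Rightarrow> real^3) \<Rightarrow> real \<times> real \<Rightarrow> real" where
  "coeff_G z p = mink (pd_v z p) (pd_v z p)"

definition coeff_L ::
    "(real \<times> real \<Rightarrow> real^3) \<Rightarrow> (real \<times> real \<Rightarrow> real^3) \<Rightarrow> real \<times> real \<Rightarrow> real" where
  "coeff_L z l p = mink (l p) (pd_u (pd_u z) p)"

text \<open>\<open>z\<^sub>u\<^sub>v\<close> means: first differentiate in \<open>u\<close>, then in \<open>v\<close>; for smooth \<open>z\<close> the order is immaterial.\<close>

definition coeff_M ::
    "(real \<times> real \<Rightarrow> real^3) \<Rightarrow> (real \<times> real \<Rightarrow> real^3) \<Rightarrow> real \<times> real \<Rightarrow> real" where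
  "coeff_M z l p = mink (l p) (pd_v (pd_u z) p)"

definition coeff_N ::
    "(real \<times> real \<Rightarrow> real^3) \<Rightarrow> (real \<times> real \<Rightarrow> real^3) \<Rightarrow> real \<times> real \<Rightarrow> real" where
  "coeff_N z l p = mink (l p) (pd_v (pd_v z) p)"

text \<open>A time-like surface \<open>z\<close> with its unit normal field \<open>l\<close>, both as functions of the parameters.
  The surface is regular because \<open>E < 0 < G\<close> forces \<open>E G - F\<^sup>2 < 0\<close>.\<close>

definition timelike_surface ::
    "(real \<times> real \<Rightarrow> real^3) \<Rightarrow> (real \<times> real \<Rightarrow> real^3) \<Rightarrow> (real \<times> real) set \<Rightarrow> bool" where
  "timelike_surface z l D \<longleftrightarrow>
     open D \<and> smooth_on z D \<and> smooth_on l D \<and>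
     (\<forall>p\<in>D. coeff_E z p < 0 \<and> coeff_G z p > 0 \<and>
        mink (l p) (l p) = 1 \<and> mink (l p) (pd_u z p) = 0 \<and> mink (l p) (pd_v z p) = 0)"

text \<open>The matrix of the Weingarten map \<open>\<gamma>\<close>, \<open>\<gamma>(z\<^sub>u) = l\<^sub>u\<close>, \<open>\<gamma>(z\<^sub>v) = l\<^sub>v\<close>, in the basis \<open>z\<^sub>u, z\<^sub>v\<close> of the
  tangent plane. Its columns are the coordinates of \<open>l\<^sub>u\<close> and \<open>l\<^sub>v\<close>.\<close>

definition weingarten_map ::
    "(real \<times> real \<Rightarrow> real^3) \<Rightarrow> (real \<times> real \<Rightarrow> real^3) \<Rightarrow> real \<times> real \<Rightarrow> real^2^2" where
  "weingarten_map z l p = (THE A.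
     pd_u l p = A$1$1 *\<^sub>R pd_u z p + A$2$1 *\<^sub>R pd_v z p \<and>
     pd_v l p = A$1$2 *\<^sub>R pd_u z p + A$2$2 *\<^sub>R pd_v z p)"

definition mean_curvature ::
    "(real \<times> real \<Rightarrow> real^3) \<Rightarrow> (real \<times> real \<Rightarrow> real^3) \<Rightarrow> real \<times> real \<Rightarrow> real" where
  "mean_curvature z l p = - (1/2) * trace (weingarten_map z l p)"

definition gauss_curvature ::
    "(real \<times> real \<Rightarrow> real^3) \<Rightarrow> (real \<times> real \<Rightarrow> real^3) \<Rightarrow> real \<times> real \<Rightarrow> real" where
  "gauss_curvature z l p = det (weingarten_map z l p)"

definition diagonalizable_on ::
    "(real \<times> real \<Rightarrow> real^3) \<Rightarrow> (real \<times> real \<Rightarrow> real^3) \<Rightarrow> (real \<times> real) set \<Rightarrow> bool" where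
  "diagonalizable_on z l D \<longleftrightarrow>
     (\<forall>p\<in>D. (mean_curvature z l p)\<^sup>2 - gauss_curvature z l p > 0)"

definition tangent_vec :: "(real \<times> real \<Rightarrow> real^3) \<Rightarrow> real \<times> real \<Rightarrow> real^2 \<Rightarrow> real^3" where
  "tangent_vec z p x = x$1 *\<^sub>R pd_u z p + x$2 *\<^sub>R pd_v z p"

text \<open>The principal curvatures are the eigenvalues of \<open>-\<gamma>\<close>; the first one belongs to the time-like
  and the second one to the space-like principal direction. If \<open>H\<^sup>2 - K > 0\<close>, the two (orthogonal)
  eigenlines have opposite causal character, so both are well defined. In principal parameters with
  \<open>E < 0 < G\<close> they are \<open>L/E\<close> and \<open>N/G\<close>, see
  \<open>principal_curvatures_principal_params\<close> below.\<close>

definition nu1 ::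
    "(real \<times> real \<Rightarrow> real^3) \<Rightarrow> (real \<times> real \<Rightarrow> real^3) \<Rightarrow> real \<times> real \<Rightarrow> real" where
  "nu1 z l p = (THE k. \<exists>x. mink (tangent_vec z p x) (tangent_vec z p x) < 0 \<and>
     weingarten_map z l p *v x = (- k) *\<^sub>R x)"

definition nu2 ::
    "(real \<times> real \<Rightarrow> real^3) \<Rightarrow> (real \<times> real \<Rightarrow> real^3) \<Rightarrow> real \<times> real \<Rightarrow> real" where
  "nu2 z l p = (THE k. \<exists>x. mink (tangent_vec z p x) (tangent_vec z p x) > 0 \<and>
     weingarten_map z l p *v x = (- k) *\<^sub>R x)"

definition principal_params ::
    "(real \<times> real \<Rightarrow> real^3) \<Rightarrow> (real \<times> real \<Rightarrow> real^3) \<Rightarrow> (real \<times> real) set \<Rightarrow> bool" where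
  "principal_params z l D \<longleftrightarrow>
     timelike_surface z l D \<and> (\<forall>p\<in>D. coeff_F z p = 0 \<and> coeff_M z l p = 0)"

abbreviation deriv_within :: "(real \<Rightarrow> real) \<Rightarrow> real set \<Rightarrow> real \<Rightarrow> real" where
  "deriv_within f I t \<equiv> vector_derivative f (at t within I)"

definition weingarten_surface ::
    "(real \<times> real \<Rightarrow> real^3) \<Rightarrow> (real \<times> real \<Rightarrow> real^3) \<Rightarrow> (real \<times> real) set \<Rightarrow>
     real set \<Rightarrow> (real \<Rightarrow> real) \<Rightarrow> (real \<Rightarrow> real) \<Rightarrow> (real \<times> real \<Rightarrow> real) \<Rightarrow> bool" where
  "weingarten_surface z l D I f g \<nu> \<longleftrightarrow>
     is_interval I \<and> interior I \<noteq> {} \<and> smooth_on f I \<and> smooth_on g I \<and>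
     (\<forall>t\<in>I. f t - g t \<noteq> 0 \<and> deriv_within f I t * deriv_within g I t \<noteq> 0) \<and>
     smooth_on \<nu> D \<and> \<nu> ` D \<subseteq> I \<and>
     (\<forall>p\<in>D. nu1 z l p = f (\<nu> p) \<and> nu2 z l p = g (\<nu> p))"

text \<open>\<open>A\<close> and \<open>B\<close> are the antiderivatives in the definition of \<open>\<lambda>\<close> and \<open>\<mu>\<close>. They are unique up to
  additive constants, which do not affect the constancy of \<open>\<lambda>\<close> and \<open>\<mu>\<close>.\<close>

definition natural_principal_params ::
    "(real \<times> real \<Rightarrow> real^3) \<Rightarrow> (real \<times> real \<Rightarrow> real^3) \<Rightarrow> (real \<times> real) set \<Rightarrow>
     real set \<Rightarrow> (real \<Rightarrow> real) \<Rightarrow> (real \<Rightarrow> real) \<Rightarrow> (real \<times> real \<Rightarrow> real) \<Rightarrow> bool" where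
  "natural_principal_params z l D I f g \<nu> \<longleftrightarrow>
     principal_params z l D \<and> diagonalizable_on z l D \<and> weingarten_surface z l D I f g \<nu> \<and>
     (\<exists>A B.
        (\<forall>t\<in>I. (A has_real_derivative deriv_within f I t / (f t - g t)) (at t within I)) \<and>
        (\<forall>t\<in>I. (B has_real_derivative deriv_within g I t / (g t - f t)) (at t within I)) \<and>
        (\<lambda>p. sqrt (- coeff_E z p) * exp (A (\<nu> p))) constant_on D \<and>
        (\<lambda>p. sqrt (coeff_G z p) * exp (B (\<nu> p))) constant_on D)"

text \<open>The remaining lemmas show that \<open>weingarten_map\<close> is well defined and that \<open>nu1\<close>, \<open>nu2\<close> are
  \<open>L/E\<close>, \<open>N/G\<close> in principal parameters.\<close>

lemma Ck_on_cong:
  assumes "\<And>x. x \<in> S \<Longrightarrow> h x = k x"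
  shows "Ck_on n h S = Ck_on n k S"
proof -
  have "(h has_derivative h') (at x within S) \<longleftrightarrow> (k has_derivative h') (at x within S)"
    if "x \<in> S" for h' x using that assms has_derivative_transform by metis
  moreover have "continuous_on S h \<longleftrightarrow> continuous_on S k"
    using assms by (intro continuous_on_cong) auto
  ultimately show ?thesis by (cases n) auto
qed

lemma mink_bilinear: "bounded_bilinear mink"
proof -
  have *: "bilinear mink"
    unfolding bilinear_def mink_def by (auto intro!: linearI simp: algebra_simps)
  show ?thesis using bilinear_conv_bounded_bilinear[of mink] * by simp
qed

lemma slice_u:
  assumes "(h has_derivative h') (at p)"
  shows "((\<lambda>s. h (s, snd p)) has_vector_derivative h' (1, 0)) (at (fst p))"
proof -
  have 1: "((\<lambda>s. (s, snd p)) has_derivative (\<lambda>s. (s, 0))) (at (fst p))"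
    by (auto intro!: derivative_eq_intros)
  have "((\<lambda>s. h (s, snd p)) has_derivative (\<lambda>s. h' (s, 0))) (at (fst p))"
    using has_derivative_compose[OF 1, of h h'] assms by simp
  moreover have "(\<lambda>s. h' (s, 0)) = (\<lambda>s. s *\<^sub>R h' (1, 0))"
  proof
    show "h' (s, 0) = s *\<^sub>R h' (1, 0)" for s
      using linear_scale[OF has_derivative_linear[OF assms], of s "(1,0)"]
      by (simp only: scaleR_Pair scaleR_zero_right real_scaleR_def mult_1_right)
  qed
  ultimately show ?thesis unfolding has_vector_derivative_def by simp
qed

lemma slice_v:
  assumes "(h has_derivative h') (at p)"
  shows "((\<lambda>t. h (fst p, t)) has_vector_derivative h' (0, 1)) (at (snd p))"
proof -
  have 1: "((\<lambda>t. (fst p, t)) has_derivative (\<lambda>s. (0, s))) (at (snd p))"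
    by (auto intro!: derivative_eq_intros)
  have "((\<lambda>s. h (fst p, s)) has_derivative (\<lambda>s. h' (0, s))) (at (snd p))"
    using has_derivative_compose[OF 1, of h h'] assms by simp
  moreover have "(\<lambda>s. h' (0, s)) = (\<lambda>s. s *\<^sub>R h' (0, 1))"
  proof
    show "h' (0, s) = s *\<^sub>R h' (0, 1)" for s
      using linear_scale[OF has_derivative_linear[OF assms], of s "(0,1)"]
      by (simp only: scaleR_Pair scaleR_zero_right real_scaleR_def mult_1_right)
  qed
  ultimately show ?thesis unfolding has_vector_derivative_def by simp
qed

lemma smooth_pd:
  assumes "smooth_on h S" "open S" "p \<in> S"
  shows "((\<lambda>s. h (s, snd p)) has_vector_derivative pd_u h p) (at (fst p))"
    and "((\<lambda>t. h (fst p, t)) has_vector_derivative pd_v h p) (at (snd p))"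
proof -
  have "Ck_on (Suc 0) h S" using assms unfolding smooth_on_def by blast
  then obtain h' where "(h has_derivative h') (at p)"
    using assms(2,3) at_within_open[of p S] by auto
  note u = slice_u[OF this] and v = slice_v[OF this]
  show "((\<lambda>s. h (s, snd p)) has_vector_derivative pd_u h p) (at (fst p))"
    using u vector_derivative_at[OF u] by (simp add: pd_u_def)
  show "((\<lambda>t. h (fst p, t)) has_vector_derivative pd_v h p) (at (snd p))"
    using v vector_derivative_at[OF v] by (simp add: pd_v_def)
qed

lemma mixed_mvt:
  fixes k ku kuv :: "real \<times> real \<Rightarrow> real"
  assumes s: "s > 0"
    and u: "\<And>x y. a \<le> x \<Longrightarrow> x \<le> a + s \<Longrightarrow> b \<le> y \<Longrightarrow> y \<le> b + s \<Longrightarrow>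
       ((\<lambda>x. k (x, y)) has_real_derivative ku (x, y)) (at x)"
    and uv: "\<And>x y. a \<le> x \<Longrightarrow> x \<le> a + s \<Longrightarrow> b \<le> y \<Longrightarrow> y \<le> b + s \<Longrightarrow>
       ((\<lambda>y. ku (x, y)) has_real_derivative kuv (x, y)) (at y)"
  shows "\<exists>x y. a < x \<and> x < a + s \<and> b < y \<and> y < b + s \<and>
     k (a + s, b + s) - k (a + s, b) - k (a, b + s) + k (a, b) = s * s * kuv (x, y)"
proof -
  have "\<exists>x. a < x \<and> x < a + s \<and> (k (a + s, b + s) - k (a + s, b)) - (k (a, b + s) - k (a, b))
      = (a + s - a) * (ku (x, b + s) - ku (x, b))"
    using s by (intro MVT2) (auto intro!: DERIV_diff u)
  then obtain x where x: "a < x" "x < a + s"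
    "(k (a + s, b + s) - k (a + s, b)) - (k (a, b + s) - k (a, b)) = s * (ku (x, b + s) - ku (x, b))"
    by auto
  have "\<exists>y. b < y \<and> y < b + s \<and> ku (x, b + s) - ku (x, b) = (b + s - b) * kuv (x, y)"
    using s x by (intro MVT2) (auto intro!: uv)
  then obtain y where y: "b < y" "y < b + s" "ku (x, b + s) - ku (x, b) = s * kuv (x, y)"
    by auto
  have "k (a + s, b + s) - k (a + s, b) - k (a, b + s) + k (a, b) = s * s * kuv (x, y)"
    using x(3) unfolding y(3) by simp
  then show ?thesis using x y by blast
qed

lemma smooth_on_pd:
  assumes "smooth_on h S" "open S"
  shows "smooth_on (pd_u h) S" "smooth_on (pd_v h) S"
proof -
  have "Ck_on k (pd_u h) S \<and> Ck_on k (pd_v h) S" for k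
  proof -
    have "Ck_on (Suc k) h S" using assms unfolding smooth_on_def by blast
    then obtain h' where h: "\<forall>x\<in>S. (h has_derivative h' x) (at x within S)"
      "\<forall>w. Ck_on k (\<lambda>x. h' x w) S" by auto
    have a: "(h has_derivative h' x) (at x)" if "x \<in> S" for x
      using h that assms(2) at_within_open by metis
    have u: "pd_u h x = h' x (1,0)" if "x \<in> S" for x
      unfolding pd_u_def using slice_u[OF a[OF that]] by (rule vector_derivative_at)
    have v: "pd_v h x = h' x (0,1)" if "x \<in> S" for x
      unfolding pd_v_def using slice_v[OF a[OF that]] by (rule vector_derivative_at)
    show ?thesis
      using Ck_on_cong[of S "pd_u h" "\<lambda>x. h' x (1,0)" k] Ck_on_cong[of S "pd_v h" "\<lambda>x. h' x (0,1)" k]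
        u v h(2) by blast
  qed
  thus "smooth_on (pd_u h) S" "smooth_on (pd_v h) S" by (auto simp: smooth_on_def)
qed

lemma smooth_continuous: "smooth_on h S \<Longrightarrow> continuous_on S h"
  unfolding smooth_on_def by (metis Ck_on.simps(1))

lemma pd_comp:
  fixes h :: "real \<times> real \<Rightarrow> real^3"
  assumes "smooth_on h S" "open S" "p \<in> S"
  shows "((\<lambda>s. h (s, snd p) $ i) has_real_derivative pd_u h p $ i) (at (fst p))"
    and "((\<lambda>t. h (fst p, t) $ i) has_real_derivative pd_v h p $ i) (at (snd p))"
  using smooth_pd(1,2)[OF assms]
  unfolding has_real_derivative_iff_has_vector_derivative
  by (auto intro: bounded_linear.has_vector_derivative[OF bounded_linear_vec_nth])

lemma pd_mixed:
  fixes h :: "real \<times> real \<Rightarrow> real^3"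
  assumes "smooth_on h S" "open S" "p \<in> S"
  shows "pd_u (pd_v h) p = pd_v (pd_u h) p"
proof -
  note sm = smooth_on_pd[OF assms(1,2)]
  note c = smooth_continuous[OF smooth_on_pd(2)[OF sm(1) assms(2)]]
    smooth_continuous[OF smooth_on_pd(1)[OF sm(2) assms(2)]]
  have "pd_u (pd_v h) p $ i = pd_v (pd_u h) p $ i" for i
  proof (rule ccontr)
    assume ne: "pd_u (pd_v h) p $ i \<noteq> pd_v (pd_u h) p $ i"
    define e where "e = \<bar>pd_u (pd_v h) p $ i - pd_v (pd_u h) p $ i\<bar> / 2"
    have e: "e > 0" using ne by (simp add: e_def)
    have "continuous_on S (\<lambda>q. pd_u (pd_v h) q $ i)" "continuous_on S (\<lambda>q. pd_v (pd_u h) q $ i)"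
      using c by (auto intro!: continuous_intros)
    hence "isCont (\<lambda>q. pd_u (pd_v h) q $ i) p" "isCont (\<lambda>q. pd_v (pd_u h) q $ i) p"
      using assms continuous_on_eq_continuous_at by blast+
    then obtain d1 d2 where d: "d1 > 0" "d2 > 0"
      "\<And>q. dist q p < d1 \<Longrightarrow> \<bar>pd_u (pd_v h) q $ i - pd_u (pd_v h) p $ i\<bar> < e"
      "\<And>q. dist q p < d2 \<Longrightarrow> \<bar>pd_v (pd_u h) q $ i - pd_v (pd_u h) p $ i\<bar> < e"
      using e unfolding continuous_at_eps_delta dist_real_def by metis
    obtain d3 where d3: "d3 > 0" "ball p d3 \<subseteq> S" using assms openE by blast
    define s where "s = min d1 (min d2 d3) / 3"
    have s: "s > 0" using d d3 by (simp add: s_def)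
    obtain a b where p: "p = (a, b)" by force
    have near: "dist (x, y) p < min d1 (min d2 d3)"
      if "a \<le> x" "x \<le> a + s" "b \<le> y" "y \<le> b + s" for x y
    proof -
      have "dist (x, y) p \<le> \<bar>x - a\<bar> + \<bar>y - b\<bar>"
        unfolding p dist_prod_def dist_real_def fst_conv snd_conv
        using sqrt_sum_squares_le_sum_abs by simp
      also have "\<dots> \<le> 2 * s" using that by simp
      also have "\<dots> < 3 * s" using s by simp
      finally show ?thesis by (simp add: s_def)
    qed
    have inS: "(x, y) \<in> S" if "a \<le> x" "x \<le> a + s" "b \<le> y" "y \<le> b + s" for x y
      using near[OF that] d3 by (auto simp: dist_commute)
    have "\<exists>x y. a < x \<and> x < a + s \<and> b < y \<and> y < b + s \<and>
      h (a + s, b + s) $ i - h (a + s, b) $ i - h (a, b + s) $ i + h (a, b) $ i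
        = s * s * pd_v (pd_u h) (x, y) $ i"
      using mixed_mvt[of s a b "\<lambda>q. h q $ i" "\<lambda>q. pd_u h q $ i" "\<lambda>q. pd_v (pd_u h) q $ i", OF s]
        pd_comp(1)[OF assms(1,2) inS] pd_comp(2)[OF sm(1) assms(2) inS] by simp
    then obtain x y where 1: "a < x" "x < a + s" "b < y" "y < b + s"
      "h (a + s, b + s) $ i - h (a + s, b) $ i - h (a, b + s) $ i + h (a, b) $ i
        = s * s * pd_v (pd_u h) (x, y) $ i" by auto
    have "\<exists>y x. b < y \<and> y < b + s \<and> a < x \<and> x < a + s \<and>
      h (a + s, b + s) $ i - h (a, b + s) $ i - h (a + s, b) $ i + h (a, b) $ i
        = s * s * pd_u (pd_v h) (x, y) $ i"
      using mixed_mvt[of s b a "\<lambda>(y,x). h (x,y) $ i" "\<lambda>(y,x). pd_v h (x,y) $ i"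
          "\<lambda>(y,x). pd_u (pd_v h) (x,y) $ i", OF s]
        pd_comp(2)[OF assms(1,2) inS] pd_comp(1)[OF sm(2) assms(2) inS] by simp
    then obtain x' y' where 2: "a < x'" "x' < a + s" "b < y'" "y' < b + s"
      "h (a + s, b + s) $ i - h (a, b + s) $ i - h (a + s, b) $ i + h (a, b) $ i
        = s * s * pd_u (pd_v h) (x', y') $ i" by auto
    have "s * s * pd_v (pd_u h) (x, y) $ i = s * s * pd_u (pd_v h) (x', y') $ i"
      using 1(5) 2(5) by linarith
    hence "pd_v (pd_u h) (x, y) $ i = pd_u (pd_v h) (x', y') $ i" using s by simp
    moreover have "\<bar>pd_v (pd_u h) (x, y) $ i - pd_v (pd_u h) p $ i\<bar> < e"
      using d(4) near[of x y] 1 by auto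
    moreover have "\<bar>pd_u (pd_v h) (x', y') $ i - pd_u (pd_v h) p $ i\<bar> < e"
      using d(3) near[of x' y'] 2 by auto
    ultimately show False unfolding e_def by argo
  qed
  thus ?thesis by (simp add: vec_eq_iff)
qed

lemma pd_mink_const:
  assumes "open D" "p \<in> D" "\<And>q. q \<in> D \<Longrightarrow> mink (a q) (b q) = c"
  shows "((\<lambda>s. a (s, snd p)) has_vector_derivative a') (at (fst p)) \<Longrightarrow>
         ((\<lambda>s. b (s, snd p)) has_vector_derivative b') (at (fst p)) \<Longrightarrow>
         mink (a p) b' + mink a' (b p) = 0"
    and "((\<lambda>t. a (fst p, t)) has_vector_derivative a') (at (snd p)) \<Longrightarrow>
         ((\<lambda>t. b (fst p, t)) has_vector_derivative b') (at (snd p)) \<Longrightarrow>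
         mink (a p) b' + mink a' (b p) = 0"
proof -
  assume a: "((\<lambda>s. a (s, snd p)) has_vector_derivative a') (at (fst p))"
         "((\<lambda>s. b (s, snd p)) has_vector_derivative b') (at (fst p))"
  have 1: "((\<lambda>s. mink (a (s, snd p)) (b (s, snd p))) has_vector_derivative
     mink (a p) b' + mink a' (b p)) (at (fst p))"
    using bounded_bilinear.has_vector_derivative[OF mink_bilinear a] by simp
  have o: "open ((\<lambda>s. (s, snd p)) -` D)"
    by (rule open_vimage[OF assms(1)]) (intro continuous_intros)
  have 2: "((\<lambda>s. mink (a (s, snd p)) (b (s, snd p))) has_vector_derivative 0) (at (fst p))"
    by (rule has_vector_derivative_transform_within_open[OF has_vector_derivative_const o])
       (use assms in auto)
  show "mink (a p) b' + mink a' (b p) = 0"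
    using vector_derivative_unique_at[OF 1 2] .
next
  assume a: "((\<lambda>t. a (fst p, t)) has_vector_derivative a') (at (snd p))"
         "((\<lambda>t. b (fst p, t)) has_vector_derivative b') (at (snd p))"
  have 1: "((\<lambda>s. mink (a (fst p, s)) (b (fst p, s))) has_vector_derivative
     mink (a p) b' + mink a' (b p)) (at (snd p))"
    using bounded_bilinear.has_vector_derivative[OF mink_bilinear a] by simp
  have o: "open ((\<lambda>s. (fst p, s)) -` D)"
    by (rule open_vimage[OF assms(1)]) (intro continuous_intros)
  have 2: "((\<lambda>s. mink (a (fst p, s)) (b (fst p, s))) has_vector_derivative 0) (at (snd p))"
    by (rule has_vector_derivative_transform_within_open[OF has_vector_derivative_const o])
       (use assms in auto)
  show "mink (a p) b' + mink a' (b p) = 0"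
    using vector_derivative_unique_at[OF 1 2] .
qed

lemma mink_lin:
  "mink (x + y) w = mink x w + mink y w" "mink w (x + y) = mink w x + mink w y"
  "mink (c *\<^sub>R x) w = c * mink x w" "mink w (c *\<^sub>R x) = c * mink w x"
  "mink (x - y) w = mink x w - mink y w"
  by (simp_all add: mink_def algebra_simps)

lemma mink_commute: "mink x y = mink y x"
  by (simp add: mink_def mult.commute)

lemma tangent_coords:
  assumes "mink a a < 0" "mink b b > 0" "mink n n = 1" "mink n a = 0" "mink n b = 0" "mink n w = 0"
  shows "\<exists>!(c, d). w = c *\<^sub>R a + d *\<^sub>R b"
proof -
  let ?E = "mink a a" and ?F = "mink a b" and ?G = "mink b b"
  define W where "W = ?E * ?G - ?F * ?F"
  have W: "W < 0"
    unfolding W_def using mult_neg_pos[OF assms(1,2)] zero_le_square[of ?F] by linarith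
  define c where "c = (?G * mink w a - ?F * mink w b) / W"
  define d where "d = (?E * mink w b - ?F * mink w a) / W"
  have cd: "c * W = ?G * mink w a - ?F * mink w b" "d * W = ?E * mink w b - ?F * mink w a"
    using W by (auto simp: c_def d_def)
  define r where "r = w - c *\<^sub>R a - d *\<^sub>R b"
  have "W * mink r a = 0"
    unfolding r_def mink_lin mink_commute[of b a] using cd unfolding W_def by algebra
  hence ra: "mink r a = 0" using W by simp
  have "W * mink r b = 0"
    unfolding r_def mink_lin mink_commute[of b a] using cd unfolding W_def by algebra
  hence rb: "mink r b = 0" using W by simp
  have rn: "mink r n = 0"
    unfolding r_def mink_lin using assms mink_commute by auto
  define \<Delta> where "\<Delta> = a$1 * (b$2 * n$3 - b$3 * n$2) - a$2 * (b$1 * n$3 - b$3 * n$1)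
     + a$3 * (b$1 * n$2 - b$2 * n$1)"
  have "\<Delta> * \<Delta> = - W"
  proof -
    have "\<Delta> * \<Delta> = - (?E * (?G * mink n n - mink n b * mink n b)
        - ?F * (?F * mink n n - mink n b * mink n a) + mink n a * (?F * mink n b - ?G * mink n a))"
      unfolding \<Delta>_def mink_def by algebra
    thus ?thesis using assms by (simp add: W_def)
  qed
  hence "\<Delta> \<noteq> 0" using W by auto
  moreover have "\<Delta> * r$1 = 0" "\<Delta> * r$2 = 0" "\<Delta> * r$3 = 0"
    using ra rb rn unfolding \<Delta>_def mink_def by algebra+
  ultimately have "r$1 = 0" "r$2 = 0" "r$3 = 0" by auto
  hence "r = 0" by (simp add: vec_eq_iff forall_3)
  hence ex: "w = c *\<^sub>R a + d *\<^sub>R b" by (simp add: r_def algebra_simps)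
  have "c' = c \<and> d' = d" if "w = c' *\<^sub>R a + d' *\<^sub>R b" for c' d'
  proof -
    have 1: "mink w a = c' * ?E + d' * ?F" "mink w b = c' * ?F + d' * ?G"
      unfolding that mink_lin mink_commute[of b a] by simp_all
    have "c' * W = c * W" "d' * W = d * W"
      using cd 1 unfolding W_def by algebra+
    thus ?thesis using W by simp
  qed
  thus ?thesis using ex by auto
qed

lemma weingarten_map_ex1:
  assumes "timelike_surface z l D" "p \<in> D"
  shows "\<exists>!A::real^2^2. pd_u l p = A$1$1 *\<^sub>R pd_u z p + A$2$1 *\<^sub>R pd_v z p \<and>
     pd_v l p = A$1$2 *\<^sub>R pd_u z p + A$2$2 *\<^sub>R pd_v z p"
proof -
  have D: "open D" "smooth_on l D"
    and n: "\<And>q. q \<in> D \<Longrightarrow> mink (l q) (l q) = 1"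
    and o: "mink (l p) (pd_u z p) = 0" "mink (l p) (pd_v z p) = 0"
    and EG: "mink (pd_u z p) (pd_u z p) < 0" "mink (pd_v z p) (pd_v z p) > 0"
    using assms by (auto simp: timelike_surface_def coeff_E_def coeff_G_def)
  note s = smooth_pd[OF D(2,1) assms(2)]
  have t: "mink (l p) (pd_u l p) = 0" "mink (l p) (pd_v l p) = 0"
    using pd_mink_const(1)[of D p l l, OF D(1) assms(2) n s(1) s(1)]
      pd_mink_const(2)[of D p l l, OF D(1) assms(2) n s(2) s(2)] mink_commute by auto
  obtain a c where ac: "pd_u l p = a *\<^sub>R pd_u z p + c *\<^sub>R pd_v z p"
     "\<And>a' c'. pd_u l p = a' *\<^sub>R pd_u z p + c' *\<^sub>R pd_v z p \<Longrightarrow> a' = a \<and> c' = c"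
    using tangent_coords[OF EG n[OF assms(2)] o t(1)] by auto blast
  obtain b d where bd: "pd_v l p = b *\<^sub>R pd_u z p + d *\<^sub>R pd_v z p"
     "\<And>b' d'. pd_v l p = b' *\<^sub>R pd_u z p + d' *\<^sub>R pd_v z p \<Longrightarrow> b' = b \<and> d' = d"
    using tangent_coords[OF EG n[OF assms(2)] o t(2)] by auto blast
  show ?thesis
  proof (rule ex1I[of _ "vector [vector [a, b], vector [c, d]]"])
    show "A = vector [vector [a, b], vector [c, d]]"
      if "pd_u l p = A$1$1 *\<^sub>R pd_u z p + A$2$1 *\<^sub>R pd_v z p \<and>
        pd_v l p = A$1$2 *\<^sub>R pd_u z p + A$2$2 *\<^sub>R pd_v z p" for A :: "real^2^2"
    proof -
      have "A$1$1 = a \<and> A$2$1 = c" "A$1$2 = b \<and> A$2$2 = d"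
        using ac(2) bd(2) that by blast+
      thus ?thesis by (simp add: vec_eq_iff forall_2)
    qed
  qed (use ac bd in simp)
qed

lemma principal_curvatures_principal_params:
  assumes "principal_params z l D" "p \<in> D"
  shows "nu1 z l p = coeff_L z l p / coeff_E z p"
    and "nu2 z l p = coeff_N z l p / coeff_G z p"
proof -
  let ?A = "weingarten_map z l p"
  have tl: "timelike_surface z l D" using assms by (simp add: principal_params_def)
  have D: "open D" "smooth_on l D" "smooth_on z D"
    and o: "\<And>q. q \<in> D \<Longrightarrow> mink (l q) (pd_u z q) = 0" "\<And>q. q \<in> D \<Longrightarrow> mink (l q) (pd_v z q) = 0"
    and EG: "coeff_E z p < 0" "coeff_G z p > 0"
    and FM: "mink (pd_u z p) (pd_v z p) = 0" "mink (l p) (pd_v (pd_u z) p) = 0"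
    using assms by (auto simp: timelike_surface_def coeff_F_def coeff_M_def principal_params_def)
  note sl = smooth_pd[OF D(2,1) assms(2)]
  have d: "((\<lambda>s. pd_u z (s, snd p)) has_vector_derivative pd_u (pd_u z) p) (at (fst p))"
     "((\<lambda>s. pd_u z (fst p, s)) has_vector_derivative pd_v (pd_u z) p) (at (snd p))"
     "((\<lambda>s. pd_v z (s, snd p)) has_vector_derivative pd_v (pd_u z) p) (at (fst p))"
     "((\<lambda>s. pd_v z (fst p, s)) has_vector_derivative pd_v (pd_v z) p) (at (snd p))"
    using smooth_pd(1,2)[OF smooth_on_pd(1)[OF D(3,1)] D(1) assms(2)]
      smooth_pd(1,2)[OF smooth_on_pd(2)[OF D(3,1)] D(1) assms(2)]
      pd_mixed[OF D(3,1) assms(2)] by simp_all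
  have w: "pd_u l p = ?A$1$1 *\<^sub>R pd_u z p + ?A$2$1 *\<^sub>R pd_v z p"
     "pd_v l p = ?A$1$2 *\<^sub>R pd_u z p + ?A$2$2 *\<^sub>R pd_v z p"
    using theI'[OF weingarten_map_ex1[OF tl assms(2)]] unfolding weingarten_map_def[symmetric]
    by blast+
  have L: "coeff_L z l p + mink (pd_u l p) (pd_u z p) = 0"
    using pd_mink_const(1)[of D p l "pd_u z", OF D(1) assms(2) o(1) sl(1) d(1)]
    by (simp add: coeff_L_def)
  have M: "mink (pd_v l p) (pd_u z p) = 0"
    using pd_mink_const(2)[of D p l "pd_u z", OF D(1) assms(2) o(1) sl(2) d(2)] FM by simp
  have M': "mink (pd_u l p) (pd_v z p) = 0"
    using pd_mink_const(1)[of D p l "pd_v z", OF D(1) assms(2) o(2) sl(1) d(3)] FM by simp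
  have N: "coeff_N z l p + mink (pd_v l p) (pd_v z p) = 0"
    using pd_mink_const(2)[of D p l "pd_v z", OF D(1) assms(2) o(2) sl(2) d(4)]
    by (simp add: coeff_N_def)
  have A11: "?A$1$1 = - (coeff_L z l p / coeff_E z p)"
    using L EG FM unfolding w mink_lin mink_commute[of "pd_v z p" "pd_u z p"]
    by (simp add: coeff_E_def field_simps)
  have A22: "?A$2$2 = - (coeff_N z l p / coeff_G z p)"
    using N EG FM unfolding w mink_lin by (simp add: coeff_G_def field_simps)
  have A12: "?A$1$2 = 0"
    using M EG FM unfolding w mink_lin mink_commute[of "pd_v z p" "pd_u z p"]
    by (simp add: coeff_E_def)
  have q: "mink (tangent_vec z p x) (tangent_vec z p x) = coeff_E z p * (x$1)\<^sup>2 + coeff_G z p * (x$2)\<^sup>2"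
    for x using FM unfolding tangent_vec_def mink_lin mink_commute[of "pd_v z p" "pd_u z p"]
    by (simp add: coeff_E_def coeff_G_def power2_eq_square algebra_simps)
  have A21: "?A$2$1 = 0"
    using M' EG FM unfolding w mink_lin by (simp add: coeff_G_def)
  have ev: "?A *v x = (- k) *\<^sub>R x \<longleftrightarrow>
      coeff_L z l p / coeff_E z p * x$1 = k * x$1 \<and> coeff_N z l p / coeff_G z p * x$2 = k * x$2"
    for k x
    by (simp add: vec_eq_iff forall_2 matrix_vector_mult_def sum_2 A11 A12 A21 A22)
  have pos: "x$1 \<noteq> 0" if "mink (tangent_vec z p x) (tangent_vec z p x) < 0" for x
  proof
    assume "x$1 = 0"
    moreover have "0 \<le> coeff_G z p * (x$2)\<^sup>2" using EG by (intro mult_nonneg_nonneg) auto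
    ultimately show False using that unfolding q by simp
  qed
  have neg: "x$2 \<noteq> 0" if "mink (tangent_vec z p x) (tangent_vec z p x) > 0" for x
  proof
    assume "x$2 = 0"
    moreover have "coeff_E z p * (x$1)\<^sup>2 \<le> 0" using EG by (intro mult_nonpos_nonneg) auto
    ultimately show False using that unfolding q by simp
  qed
  show "nu1 z l p = coeff_L z l p / coeff_E z p"
    unfolding nu1_def
  proof (rule the_equality)
    show "\<exists>x. mink (tangent_vec z p x) (tangent_vec z p x) < 0 \<and>
      ?A *v x = (- (coeff_L z l p / coeff_E z p)) *\<^sub>R x"
      unfolding ev q by (rule exI[of _ "vector [1, 0]"]) (use EG in simp)
  next
    fix k assume "\<exists>x. mink (tangent_vec z p x) (tangent_vec z p x) < 0 \<and> ?A *v x = (- k) *\<^sub>R x"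
    thus "k = coeff_L z l p / coeff_E z p" unfolding ev using pos by (metis mult_right_cancel)
  qed
  show "nu2 z l p = coeff_N z l p / coeff_G z p"
    unfolding nu2_def
  proof (rule the_equality)
    show "\<exists>x. mink (tangent_vec z p x) (tangent_vec z p x) > 0 \<and>
      ?A *v x = (- (coeff_N z l p / coeff_G z p)) *\<^sub>R x"
      unfolding ev q by (rule exI[of _ "vector [0, 1]"]) (use EG in simp)
  next
    fix k assume "\<exists>x. mink (tangent_vec z p x) (tangent_vec z p x) > 0 \<and> ?A *v x = (- k) *\<^sub>R x"
    thus "k = coeff_N z l p / coeff_G z p" unfolding ev using neg by (metis mult_right_cancel)
  qed
qed

end

theory Submission
  imports Defs
begin

text \<open>Let \<open>X, Y\<close> be the unit principal frame, with \<open>\<langle>X, X\<rangle> = -1\<close> and \<open>\<langle>Y, Y\<rangle> = 1\<close>. The Codazzi equations say that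
  the 1-forms \<open>e\<^sup>A \<langle>dz, X\<rangle>\<close> and \<open>e\<^sup>B \<langle>dz, Y\<rangle>\<close> are closed, where \<open>A' = f' / (f - g)\<close> and
  \<open>B' = g' / (g - f)\<close>, evaluated at \<open>\<nu>\<close>. Their local potentials are coordinates by the inverse function theorem,
  and in these \<open>z\<^sub>u = - e\<^bsup>-A\<^esup> X\<close>, \<open>z\<^sub>v = e\<^bsup>-B\<^esup> Y\<close>, so that \<open>\<lambda> = \<mu> = 1\<close>. In particular, principal
  parameters need not be constructed first.\<close>

section \<open>Calculus of smooth functions\<close>

text \<open>The exponent comes from Codazzi: for \<open>\<omega> = \<langle>dz, X\<rangle>\<close>,
  differentiating \<open>\<langle>dl, X\<rangle> = - f \<omega>\<close> gives d\<omega> = - (df / (f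
  - g)) \<and> \<omega>. The Weingarten condition enters here: df / (f - g) is a function of \<nu>
  times d\<nu>, hence exact, so the exponential of its primitive is an integrating factor. The same
  holds for Y with f and g exchanged. Two obstacles shape the work. The Weingarten map and the
  principal curvatures are pointwise descriptions without evident regularity; the smoothness of the
  frame has to come from f, g and \<nu>. And \<open>I\<close> may contain its end points, so
  one-variable calculus is carried out within \<open>I\<close>. In the new coordinates the
  fundamental forms and curvatures are computed afresh, which replaces an argument that they are
  invariant under reparametrization.\<close>

declare Ck_on.simps(2)[simp del]

lemma Ck_on_SucI:
  assumes "\<And>x. x \<in> S \<Longrightarrow> (h has_derivative h' x) (at x within S)"
    and "\<And>w. Ck_on k (\<lambda>x. h' x w) S"
  shows "Ck_on (Suc k) h S"
  unfolding Ck_on.simps using assms by blast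

lemma Ck_on_SucE:
  assumes "Ck_on (Suc k) h S"
  obtains h' where "\<And>x. x \<in> S \<Longrightarrow> (h has_derivative h' x) (at x within S)"
    and "\<And>w. Ck_on k (\<lambda>x. h' x w) S"
  using assms unfolding Ck_on.simps by blast

lemma Ck_on_Suc_imp: "Ck_on (Suc k) h S \<Longrightarrow> Ck_on k h S"
proof (induction k arbitrary: h)
  case 0
  then show ?case
    unfolding Ck_on.simps(1) continuous_on_eq_continuous_within
    by (meson Ck_on_SucE has_derivative_continuous)
next
  case (Suc k)
  from Suc.prems obtain h' where "\<And>x. x \<in> S \<Longrightarrow> (h has_derivative h' x) (at x within S)"
    and "\<And>w. Ck_on (Suc k) (\<lambda>x. h' x w) S" by (rule Ck_on_SucE) blast
  then show ?case using Suc.IH by (intro Ck_on_SucI[of _ _ h']) auto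
qed

lemma Ck_on_subset: "Ck_on k h S \<Longrightarrow> T \<subseteq> S \<Longrightarrow> Ck_on k h T"
proof (induction k arbitrary: h)
  case 0 then show ?case by (auto intro: continuous_on_subset)
next
  case (Suc k)
  from Suc.prems(1) obtain h' where "\<And>x. x \<in> S \<Longrightarrow> (h has_derivative h' x) (at x within S)"
    and "\<And>w. Ck_on k (\<lambda>x. h' x w) S" by (rule Ck_on_SucE) blast
  then show ?case using Suc.IH Suc.prems(2) by (intro Ck_on_SucI[of _ _ h']) (blast intro: has_derivative_subset)+
qed

lemma Ck_on_const: "Ck_on k (\<lambda>x. c) S"
proof (induction k arbitrary: c)
  case (Suc k) then show ?case by (intro Ck_on_SucI[of _ _ "\<lambda>x w. 0"]) auto
qed simp

lemma Ck_on_bounded_linear: "bounded_linear L \<Longrightarrow> Ck_on k h S \<Longrightarrow> Ck_on k (\<lambda>x. L (h x)) S"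
proof (induction k arbitrary: h)
  case 0 then show ?case
    by (auto intro: continuous_intros bounded_linear.continuous_on)
next
  case (Suc k)
  from Suc.prems(2) obtain h' where "\<And>x. x \<in> S \<Longrightarrow> (h has_derivative h' x) (at x within S)"
    and "\<And>w. Ck_on k (\<lambda>x. h' x w) S" by (rule Ck_on_SucE) blast
  then show ?case using Suc
    by (intro Ck_on_SucI[of _ _ "\<lambda>x w. L (h' x w)"]) (auto intro: bounded_linear.has_derivative)
qed

lemma Ck_on_add: "Ck_on k h1 S \<Longrightarrow> Ck_on k h2 S \<Longrightarrow> Ck_on k (\<lambda>x. h1 x + h2 x) S"
proof (induction k arbitrary: h1 h2)
  case 0 then show ?case by (auto intro: continuous_intros)
next
  case (Suc k)
  from Suc.prems(1) obtain h1' where "\<And>x. x \<in> S \<Longrightarrow> (h1 has_derivative h1' x) (at x within S)"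
    and "\<And>w. Ck_on k (\<lambda>x. h1' x w) S" by (rule Ck_on_SucE) blast
  moreover from Suc.prems(2) obtain h2' where "\<And>x. x \<in> S \<Longrightarrow> (h2 has_derivative h2' x) (at x within S)"
    and "\<And>w. Ck_on k (\<lambda>x. h2' x w) S" by (rule Ck_on_SucE) blast
  ultimately show ?case using Suc
    by (intro Ck_on_SucI[of _ _ "\<lambda>x w. h1' x w + h2' x w"]) (auto intro: has_derivative_add)
qed

lemma Ck_on_sum: "(\<And>i. i \<in> J \<Longrightarrow> Ck_on k (h i) S) \<Longrightarrow> Ck_on k (\<lambda>x. \<Sum>i\<in>J. h i x) S"
proof (induction J rule: infinite_finite_induct)
  case (insert j J)
  then show ?case by (simp add: Ck_on_add del: Ck_on.simps)
qed (simp_all add: Ck_on_const del: Ck_on.simps)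

lemma Ck_on_bilinear:
  assumes "bounded_bilinear b"
  shows "Ck_on k h1 S \<Longrightarrow> Ck_on k h2 S \<Longrightarrow> Ck_on k (\<lambda>x. b (h1 x) (h2 x)) S"
proof (induction k arbitrary: h1 h2)
  case 0 then show ?case using assms by (auto intro: bounded_bilinear.continuous_on)
next
  case (Suc k)
  from Suc.prems(1) obtain h1' where h1: "\<And>x. x \<in> S \<Longrightarrow> (h1 has_derivative h1' x) (at x within S)"
    "\<And>w. Ck_on k (\<lambda>x. h1' x w) S" by (rule Ck_on_SucE) blast
  from Suc.prems(2) obtain h2' where h2: "\<And>x. x \<in> S \<Longrightarrow> (h2 has_derivative h2' x) (at x within S)"
    "\<And>w. Ck_on k (\<lambda>x. h2' x w) S" by (rule Ck_on_SucE) blast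
  show ?case
    by (rule Ck_on_SucI[of _ _ "\<lambda>x w. b (h1 x) (h2' x w) + b (h1' x w) (h2 x)"])
       (intro bounded_bilinear.FDERIV[OF assms] h1 h2 Ck_on_add Suc.IH Suc.prems[THEN Ck_on_Suc_imp] | assumption)+
qed

text \<open>The chain rule yields \<open>h' (g x) (g' x w)\<close>, whose direction varies with
  \<open>x\<close>, while \<open>Ck_on\<close> controls derivatives in fixed directions only.
  Expanding \<open>g' x w\<close> in the basis gives a finite sum of products, to which the
  induction hypothesis and the product rule apply.\<close>

lemma Ck_on_compose:
  assumes "g ` T \<subseteq> S"
  shows "Ck_on k h S \<Longrightarrow> Ck_on k g T \<Longrightarrow> Ck_on k (\<lambda>x. h (g x)) T"
proof (induction k arbitrary: h)
  case 0
  then show ?case using assms by (auto intro: continuous_on_compose2)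
next
  case (Suc k)
  from Suc.prems(1) obtain h' where h: "\<And>x. x \<in> S \<Longrightarrow> (h has_derivative h' x) (at x within S)"
    "\<And>w. Ck_on k (\<lambda>x. h' x w) S" by (rule Ck_on_SucE) blast
  from Suc.prems(2) obtain g' where g: "\<And>x. x \<in> T \<Longrightarrow> (g has_derivative g' x) (at x within T)"
    "\<And>w. Ck_on k (\<lambda>x. g' x w) T" by (rule Ck_on_SucE) blast
  have "((\<lambda>x. h (g x)) has_derivative (\<lambda>w. \<Sum>b\<in>Basis. (g' x w \<bullet> b) *\<^sub>R h' (g x) b)) (at x within T)"
    if x: "x \<in> T" for x
  proof -
    have "((\<lambda>x. h (g x)) has_derivative (\<lambda>w. h' (g x) (g' x w))) (at x within T)"
      using x assms by (intro has_derivative_in_compose2[of S h h' g T]) (auto intro: h g)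
    moreover have "h' (g x) (g' x w) = (\<Sum>b\<in>Basis. (g' x w \<bullet> b) *\<^sub>R h' (g x) b)" for w
    proof -
      interpret linear "h' (g x)"
        using h(1)[of "g x"] x assms by (auto dest: has_derivative_linear)
      show ?thesis by (subst euclidean_representation[symmetric, of "g' x w"]) (simp only: sum scale)
    qed
    ultimately show ?thesis by simp
  qed
  moreover have "Ck_on k (\<lambda>x. \<Sum>b\<in>Basis. (g' x w \<bullet> b) *\<^sub>R h' (g x) b) T" for w
    by (intro Ck_on_sum Ck_on_bilinear[OF bounded_bilinear_scaleR]
        Ck_on_bounded_linear[OF bounded_linear_inner_left] g(2) Suc.IH h(2) Ck_on_Suc_imp[OF Suc.prems(2)])
  ultimately show ?case by (rule Ck_on_SucI)
qed

section \<open>Closure properties of smooth functions\<close>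

lemma smooth_on_cong: "(\<And>x. x \<in> S \<Longrightarrow> h x = k x) \<Longrightarrow> smooth_on h S \<longleftrightarrow> smooth_on k S"
  unfolding smooth_on_def using Ck_on_cong by blast

lemma smooth_on_subset: "smooth_on h S \<Longrightarrow> T \<subseteq> S \<Longrightarrow> smooth_on h T"
  unfolding smooth_on_def using Ck_on_subset by blast

lemma smooth_on_const: "smooth_on (\<lambda>x. c) S"
  unfolding smooth_on_def using Ck_on_const by blast

lemma smooth_on_bounded_linear: "bounded_linear L \<Longrightarrow> smooth_on h S \<Longrightarrow> smooth_on (\<lambda>x. L (h x)) S"
  unfolding smooth_on_def using Ck_on_bounded_linear by blast

lemma smooth_on_add: "smooth_on h1 S \<Longrightarrow> smooth_on h2 S \<Longrightarrow> smooth_on (\<lambda>x. h1 x + h2 x) S"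
  unfolding smooth_on_def using Ck_on_add by blast

lemma smooth_on_bilinear:
  "bounded_bilinear b \<Longrightarrow> smooth_on h1 S \<Longrightarrow> smooth_on h2 S \<Longrightarrow> smooth_on (\<lambda>x. b (h1 x) (h2 x)) S"
  unfolding smooth_on_def using Ck_on_bilinear by blast

lemmas smooth_on_scaleR = smooth_on_bilinear[OF bounded_bilinear_scaleR]
lemmas smooth_on_mult = smooth_on_bilinear[OF bounded_bilinear_mult]
lemmas smooth_on_mink = smooth_on_bilinear[OF mink_bilinear]

lemma smooth_on_uminus: "smooth_on h S \<Longrightarrow> smooth_on (\<lambda>x. - h x) S"
  by (rule smooth_on_bounded_linear[OF bounded_linear_minus[OF bounded_linear_ident]])

lemma smooth_on_diff: "smooth_on h1 S \<Longrightarrow> smooth_on h2 S \<Longrightarrow> smooth_on (\<lambda>x. h1 x - h2 x) S"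
  using smooth_on_add[OF _ smooth_on_uminus] by simp

lemma smooth_on_compose:
  "smooth_on h S \<Longrightarrow> smooth_on g T \<Longrightarrow> g ` T \<subseteq> S \<Longrightarrow> smooth_on (\<lambda>x. h (g x)) T"
  unfolding smooth_on_def using Ck_on_compose by blast

lemma smooth_on_Pair:
  assumes "smooth_on h1 S" "smooth_on h2 S"
  shows "smooth_on (\<lambda>x. (h1 x, h2 x)) S"
  using smooth_on_add[OF smooth_on_bounded_linear[OF bounded_linear_Pair[OF bounded_linear_ident bounded_linear_zero] assms(1)]
     smooth_on_bounded_linear[OF bounded_linear_Pair[OF bounded_linear_zero bounded_linear_ident] assms(2)]]
  by simp

lemma smooth_onI:
  assumes "\<And>x. x \<in> S \<Longrightarrow> (h has_derivative h' x) (at x within S)"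
    and "\<And>w. smooth_on (\<lambda>x. h' x w) S"
  shows "smooth_on h S"
  unfolding smooth_on_def
proof
  show "Ck_on k h S" for k
    by (rule Ck_on_Suc_imp, rule Ck_on_SucI[OF assms(1)]) (use assms(2) in \<open>auto simp: smooth_on_def\<close>)
qed

text \<open>For \<open>h\<close> whose derivative is a smooth expression in \<open>h\<close> itself, such as an inverse function.\<close>

lemma smooth_on_bootstrap:
  assumes "\<And>x. x \<in> S \<Longrightarrow> (h has_derivative h' x) (at x within S)"
    and "\<And>k w. Ck_on k h S \<Longrightarrow> Ck_on k (\<lambda>x. h' x w) S"
  shows "smooth_on h S"
proof -
  have "Ck_on k h S" for k
  proof (induction k)
    case 0
    then show ?case using assms(1)
      by (auto simp: continuous_on_eq_continuous_within intro: has_derivative_continuous)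
  qed (rule Ck_on_SucI[OF assms])
  then show ?thesis by (simp add: smooth_on_def)
qed

section \<open>Smoothness of the reciprocal, the exponential and the square root\<close>

lemma smooth_on_real_inverse: "smooth_on inverse (- {0::real})"
proof (rule smooth_on_bootstrap)
  show "(inverse has_derivative (\<lambda>w. - (inverse x * w * inverse x))) (at x within - {0})"
    if "x \<in> - {0}" for x :: real
    using that by (intro has_derivative_inverse') auto
next
  fix k and w :: real assume *: "Ck_on k inverse (- {0::real})"
  have "(\<lambda>x::real. - (inverse x * w * inverse x)) = (\<lambda>x. inverse x * ((- w) * inverse x))"
    by (simp add: fun_eq_iff ac_simps)
  then show "Ck_on k (\<lambda>x::real. - (inverse x * w * inverse x)) (- {0})"
    by (simp only:) (intro Ck_on_bilinear[OF bounded_bilinear_mult] Ck_on_const *)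
qed

lemma smooth_on_exp: "smooth_on exp (UNIV :: real set)"
proof (rule smooth_on_bootstrap)
  show "(exp has_derivative (\<lambda>w. w * exp x)) (at x within UNIV)" for x :: real
    by (auto intro!: derivative_eq_intros)
qed (rule Ck_on_bilinear[OF bounded_bilinear_mult Ck_on_const])

lemma smooth_on_sqrt: "smooth_on sqrt {0<..}"
proof (rule smooth_on_bootstrap)
  show "(sqrt has_derivative (\<lambda>w. w * (inverse (sqrt x) * (1/2)))) (at x within {0<..})"
    if "x \<in> {0<..}" for x :: real
    using that by (auto intro!: derivative_eq_intros simp: field_simps)
next
  fix k and w :: real assume *: "Ck_on k sqrt {0<..}"
  have "Ck_on k (\<lambda>x. inverse (sqrt x)) {0<..}"
    by (rule Ck_on_compose[of _ _ "- {0}"]) (use smooth_on_real_inverse * in \<open>auto simp: smooth_on_def\<close>)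
  then show "Ck_on k (\<lambda>x. w * (inverse (sqrt x) * (1/2))) {0<..}"
    by (intro Ck_on_bilinear[OF bounded_bilinear_mult] Ck_on_const)
qed

lemma smooth_on_inverse:
  fixes h :: "'a::euclidean_space \<Rightarrow> real"
  shows "smooth_on h S \<Longrightarrow> (\<And>x. x \<in> S \<Longrightarrow> h x \<noteq> 0) \<Longrightarrow> smooth_on (\<lambda>x. inverse (h x)) S"
  by (rule smooth_on_compose[OF smooth_on_real_inverse]) auto

section \<open>Antiderivatives, closed forms and plane coordinates\<close>

text \<open>The fundamental theorem is applied on compact intervals, but \<open>I\<close> may be
  unbounded or lack end points. For each \<open>t\<close> a compact \<open>{a..b}\<close> inside
  \<open>I\<close> is chosen that contains the base point \<open>c\<close> and agrees with
  \<open>I\<close> near \<open>t\<close>: each of its ends lies strictly beyond \<open>t\<close> or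
  is an end point of \<open>I\<close>.\<close>

lemma interval_antiderivative:
  fixes h :: "real \<Rightarrow> real"
  assumes "is_interval I" "continuous_on I h"
  obtains A where "\<And>t. t \<in> I \<Longrightarrow> (A has_real_derivative h t) (at t within I)"
proof (cases "I = {}")
  case False
  then obtain c where c: "c \<in> I" by blast
  define A where "A t = (LBINT y=c..t. h y)" for t :: real
  have "(A has_real_derivative h t) (at t within I)" if t: "t \<in> I" for t
  proof -
    obtain a where a: "a \<in> I" "a \<le> c" "a \<le> t" "a < t \<or> (\<forall>y\<in>I. a \<le> y)"
    proof (cases "\<exists>y\<in>I. y < t")
      case True
      then obtain y where "y \<in> I" "y < t" by blast
      then show thesis using that[of "min y c"] c by (auto simp: min_def)
    next
      case False
      then show thesis using that[of t] c t by force
    qed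
    obtain b where b: "b \<in> I" "c \<le> b" "t \<le> b" "t < b \<or> (\<forall>y\<in>I. y \<le> b)"
    proof (cases "\<exists>y\<in>I. t < y")
      case True
      then obtain y where "y \<in> I" "t < y" by blast
      then show thesis using that[of "max y c"] c by (auto simp: max_def)
    next
      case False
      then show thesis using that[of t] c t by force
    qed
    have ab: "{a..b} \<subseteq> I"
      using mem_is_interval_1_I[OF assms(1) a(1) b(1)] by auto
    have "((\<lambda>u. LBINT y=c..u. h y) has_vector_derivative h t) (at t within {a..b})"
      using a b by (intro interval_integral_FTC2 continuous_on_subset[OF assms(2) ab]) auto
    moreover have "at t within {a..b} = at t within I"
    proof (rule at_within_nhd)
      \<comment> \<open>This neighbourhood of \<open>t\<close> cuts off exactly those ends that lie
        strictly beyond \<open>t\<close>; an end equal to \<open>t\<close> is also an end of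
        \<open>I\<close> and needs no cutting.\<close>
      show "t \<in> (if a < t then {a<..} else UNIV) \<inter> (if t < b then {..<b} else UNIV)" by auto
      show "{a..b} \<inter> ((if a < t then {a<..} else UNIV) \<inter> (if t < b then {..<b} else UNIV)) - {t}
          = I \<inter> ((if a < t then {a<..} else UNIV) \<inter> (if t < b then {..<b} else UNIV)) - {t}"
        using ab a b by (auto intro: order_antisym)
    qed auto
    ultimately show ?thesis
      unfolding A_def has_real_derivative_iff_has_vector_derivative by simp
  qed
  then show thesis by (rule that)
qed (simp add: that)

text \<open>A connected set with more than one point has no isolated points. This makes derivatives
  within \<open>I\<close> unique.\<close>

lemma at_within_interval_nontrivial:
  fixes t :: real
  assumes "is_interval I" "interior I \<noteq> {}" "t \<in> I"
  shows "at t within I \<noteq> bot"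
proof -
  have "I \<noteq> {t}" using assms(2) by auto
  then have "t islimpt I"
    using assms is_interval_connected by (intro connected_imp_perfect) auto
  then show ?thesis by (simp add: trivial_limit_within)
qed

text \<open>Links the derivative witness hidden in \<open>Ck_on\<close> to
  \<open>deriv_within\<close>: a linear map on the line is multiplication by its value at 1, and
  uniqueness within \<open>I\<close> identifies that value.\<close>

lemma smooth_on_deriv_within:
  assumes "smooth_on f I" "is_interval I" "interior I \<noteq> {}"
  shows "t \<in> I \<Longrightarrow> (f has_real_derivative deriv_within f I t) (at t within I)"
    and "smooth_on (deriv_within f I) I"
proof -
  have *: "f' 1 = deriv_within f I t"
    if "t \<in> I" "(f has_derivative f') (at t within I)" for f' t
  proof -
    have "(\<lambda>w. w *\<^sub>R f' 1) = f'"
      using linear_scale[OF has_derivative_linear[OF that(2)], of _ 1, symmetric] by (simp add: fun_eq_iff)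
    then have "(f has_vector_derivative f' 1) (at t within I)"
      using that(2) unfolding has_vector_derivative_def by simp
    then show ?thesis
      using vector_derivative_within[OF at_within_interval_nontrivial[OF assms(2,3) that(1)], of f "f' 1"]
      by simp
  qed
  show "(f has_real_derivative deriv_within f I t) (at t within I)" if t: "t \<in> I"
  proof -
    have "Ck_on (Suc 0) f I" using assms unfolding smooth_on_def by blast
    then obtain F where "\<And>t. t \<in> I \<Longrightarrow> (f has_derivative F t) (at t within I)"
      by (rule Ck_on_SucE) blast
    with t obtain f' where f': "(f has_derivative f') (at t within I)" by blast
    have "(\<lambda>w. w *\<^sub>R f' 1) = f'"
      using linear_scale[OF has_derivative_linear[OF f'], of _ 1, symmetric] by (simp add: fun_eq_iff)
    then show ?thesis using f' *[OF t f']
      unfolding has_real_derivative_iff_has_vector_derivative has_vector_derivative_def by simp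
  qed
  show "smooth_on (deriv_within f I) I"
    unfolding smooth_on_def
  proof
    fix k
    have "Ck_on (Suc k) f I" using assms unfolding smooth_on_def by blast
    then obtain f' where "\<And>t. t \<in> I \<Longrightarrow> (f has_derivative f' t) (at t within I)"
      and "\<And>w. Ck_on k (\<lambda>t. f' t w) I" by (rule Ck_on_SucE) blast
    then show "Ck_on k (deriv_within f I) I"
      using * Ck_on_cong[of I "\<lambda>t. f' t 1" "deriv_within f I" k] by metis
  qed
qed

lemma smooth_on_has_derivative_plane:
  assumes "smooth_on h D" "open D" "q \<in> D"
  shows "(h has_derivative (\<lambda>w. fst w *\<^sub>R pd_u h q + snd w *\<^sub>R pd_v h q)) (at q)"
proof -
  have "Ck_on (Suc 0) h D" using assms unfolding smooth_on_def by blast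
  then obtain H where "\<And>q. q \<in> D \<Longrightarrow> (h has_derivative H q) (at q within D)"
    by (rule Ck_on_SucE) blast
  from this[OF assms(3)] obtain h' where h': "(h has_derivative h') (at q)"
    unfolding at_within_open[OF assms(3,2)] by blast
  have "h' w = fst w *\<^sub>R pd_u h q + snd w *\<^sub>R pd_v h q" for w
  proof -
    interpret linear h' using h' by (rule has_derivative_linear)
    have "h' w = h' (fst w *\<^sub>R (1,0) + snd w *\<^sub>R (0,1))" by (cases w) simp
    also have "\<dots> = fst w *\<^sub>R h' (1,0) + snd w *\<^sub>R h' (0,1)" by (simp only: add scale)
    finally show ?thesis
      using vector_derivative_at[OF slice_u[OF h']] vector_derivative_at[OF slice_v[OF h']]
      by (simp add: pd_u_def pd_v_def)
  qed
  then show ?thesis using h' by presburger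
qed

lemma pd_eqI:
  assumes "(h has_derivative h') (at q)"
  shows "pd_u h q = h' (1, 0)" "pd_v h q = h' (0, 1)"
  using vector_derivative_at[OF slice_u[OF assms]] vector_derivative_at[OF slice_v[OF assms]]
  by (simp_all add: pd_u_def pd_v_def)

text \<open>The Poincare lemma on a rectangle: integrate from the corner \<open>(a, c)\<close> up
  the left side, then horizontally. The horizontal derivative is immediate. In the vertical one,
  Leibniz's rule and closedness produce the integral of \<open>pd_u Q\<close>, that is
  \<open>Q (x, y) - Q (a, y)\<close>, and the other summand contributes
  \<open>Q (a, y)\<close>.\<close>

lemma closed_form_potential:
  fixes P Q :: "real \<times> real \<Rightarrow> real"
  assumes sm: "smooth_on P D" "smooth_on Q D" and D: "open D" "{a..b} \<times> {c..d} \<subseteq> D"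
    and closed: "\<And>q. q \<in> D \<Longrightarrow> pd_v P q = pd_u Q q"
  shows "\<exists>\<psi>. \<forall>q\<in>{a<..<b} \<times> {c<..<d}.
    (\<psi> has_derivative (\<lambda>w. fst w * P q + snd w * Q q)) (at q)"
proof -
  note cP = continuous_on_subset[OF smooth_continuous[OF sm(1)] D(2)]
    and cQ = continuous_on_subset[OF smooth_continuous[OF sm(2)] D(2)]
    and cPv = continuous_on_subset[OF smooth_continuous[OF smooth_on_pd(2)[OF sm(1) D(1)]] D(2)]
  define \<psi> where "\<psi> x y = integral {a..x} (\<lambda>s. P (s, y)) + integral {c..y} (\<lambda>t. Q (a, t))" for x y
  have "((\<lambda>(x, y). \<psi> x y) has_derivative (\<lambda>w. fst w * P q + snd w * Q q)) (at q)"
    if q: "q \<in> {a<..<b} \<times> {c<..<d}" for q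
  proof -
    obtain x y where xy: "q = (x, y)" "a < x" "x < b" "c < y" "y < d" using q by force
    have x': "((\<lambda>x. \<psi> x y) has_derivative (\<lambda>w. P (x, y) * w)) (at x within {a<..<b})"
    proof -
      have "((\<lambda>x. integral {a..x} (\<lambda>s. P (s, y))) has_real_derivative P (x, y)) (at x within {a..b})"
        using xy by (intro integral_has_real_derivative continuous_on_compose2[OF cP] continuous_intros) auto
      then have "((\<lambda>x. \<psi> x y) has_real_derivative P (x, y)) (at x within {a..b})"
        unfolding \<psi>_def by (auto intro!: derivative_eq_intros)
      then show ?thesis
        unfolding has_field_derivative_def by (rule has_derivative_subset) auto
    qed
    \<comment> \<open>Joint differentiability follows from one partial at the given point, if the
      other exists on the whole rectangle and is continuous at that point as a bounded linear map.
      Hence the local \<open>x\<close> and \<open>y\<close> here range over the rectangle.\<close>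
    have y': "((\<lambda>y. \<psi> x y) has_derivative blinfun_mult_right (Q (x, y))) (at y within {c<..<d})"
      if "x \<in> {a<..<b}" "y \<in> {c<..<d}" for x y
    proof -
      have inD: "(s, t) \<in> D" if "s \<in> {a..x}" "t \<in> {c..d}" for s t
        using D(2) that \<open>x \<in> _\<close> by auto
      have 1: "((\<lambda>y. integral (cbox a x) (\<lambda>s. P (s, y))) has_real_derivative
          integral (cbox a x) (\<lambda>s. pd_v P (s, y))) (at y within {c..d})"
      proof (rule leibniz_rule_field_derivative)
        show "((\<lambda>y. P (s, y)) has_real_derivative pd_v P (s, y)) (at y within {c..d})"
          if "y \<in> {c..d}" "s \<in> cbox a x" for s y
          using smooth_pd(2)[OF sm(1) D(1) inD[of s y]] that
          by (auto simp: has_real_derivative_iff_has_vector_derivative intro: has_vector_derivative_at_within)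
        show "(\<lambda>s. P (s, y)) integrable_on cbox a x" if "y \<in> {c..d}" for y
          using that \<open>x \<in> _\<close>
          by (intro integrable_continuous continuous_on_compose2[OF cP] continuous_intros) auto
        show "continuous_on ({c..d} \<times> cbox a x) (\<lambda>(y, s). pd_v P (s, y))"
          using \<open>x \<in> _\<close> unfolding split_beta
          by (intro continuous_on_compose2[OF cPv] continuous_intros) auto
      qed (use that in auto)
      have "((\<lambda>s. pd_u Q (s, y)) has_integral (Q (x, y) - Q (a, y))) {a..x}"
      proof (rule fundamental_theorem_of_calculus)
        show "((\<lambda>s. Q (s, y)) has_vector_derivative pd_u Q (s, y)) (at s within {a..x})"
          if "s \<in> {a..x}" for s
          using smooth_pd(1)[OF sm(2) D(1) inD[OF that, of y]] \<open>y \<in> _\<close>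
          by (auto intro: has_vector_derivative_at_within)
      qed (use that in auto)
      then have 2: "integral {a..x} (\<lambda>s. pd_v P (s, y)) = Q (x, y) - Q (a, y)"
        using closed inD \<open>y \<in> _\<close> by (subst integral_cong[of _ _ "\<lambda>s. pd_u Q (s, y)"]) auto
      have 3: "((\<lambda>y. integral {c..y} (\<lambda>t. Q (a, t))) has_real_derivative Q (a, y)) (at y within {c..d})"
        using that by (intro integral_has_real_derivative continuous_on_compose2[OF cQ] continuous_intros) auto
      have "((\<lambda>y. \<psi> x y) has_real_derivative Q (x, y)) (at y within {c..d})"
        using DERIV_add[OF 1 3] 2 unfolding \<psi>_def by simp
      then show ?thesis
        unfolding has_field_derivative_def blinfun_mult_right.rep_eq by (rule has_derivative_subset) auto
    qed
    have "continuous_on ({a<..<b} \<times> {c<..<d}) (\<lambda>q. blinfun_mult_right (Q q))"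
      by (intro bounded_linear.continuous_on[OF bounded_linear_blinfun_mult_right]
          continuous_on_subset[OF cQ]) auto
    then have "continuous (at (x, y) within {a<..<b} \<times> {c<..<d}) (\<lambda>(x, y). blinfun_mult_right (Q (x, y)))"
      using xy by (simp add: continuous_on_eq_continuous_within case_prod_unfold)
    from has_derivative_partialsI[OF x' y' this] xy
    have "((\<lambda>(x, y). \<psi> x y) has_derivative (\<lambda>(s, t). P (x, y) * s + Q (x, y) * t))
        (at (x, y) within {a<..<b} \<times> {c<..<d})"
      by (simp add: split_beta)
    moreover have "at q within {a<..<b} \<times> {c<..<d} = at q"
      using q by (intro at_within_open open_Times) auto
    moreover have "(\<lambda>(s, t). P (x, y) * s + Q (x, y) * t) = (\<lambda>w. fst w * P q + snd w * Q q)"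
      using xy by (auto simp: fun_eq_iff)
    ultimately show ?thesis using xy(1) by simp
  qed
  then show ?thesis by blast
qed

text \<open>The inverse function theorem gives the derivative of \<open>\<phi>\<close> only as an
  abstract inverse. Cramer's rule makes it explicit, hence a smooth expression in
  \<open>\<phi>\<close> itself, and the bootstrap then gives smoothness of all orders.\<close>

lemma plane_coordinates:
  fixes \<psi>1 \<psi>2 a b c d :: "real \<times> real \<Rightarrow> real"
  assumes U: "open U" "p \<in> U"
    and d1: "\<And>q. q \<in> U \<Longrightarrow> (\<psi>1 has_derivative (\<lambda>w. fst w * a q + snd w * b q)) (at q)"
    and d2: "\<And>q. q \<in> U \<Longrightarrow> (\<psi>2 has_derivative (\<lambda>w. fst w * c q + snd w * d q)) (at q)"
    and sm: "smooth_on a U" "smooth_on b U" "smooth_on c U" "smooth_on d U"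
    and nz: "\<And>q. q \<in> U \<Longrightarrow> a q * d q - b q * c q \<noteq> 0"
  shows "\<exists>U' V \<phi>. p \<in> U' \<and> U' \<subseteq> U \<and> smooth_diffeo V U' \<phi> (\<lambda>q. (\<psi>1 q, \<psi>2 q)) \<and>
    (\<forall>y\<in>V. (\<phi> has_derivative (\<lambda>w.
       ((fst w * d (\<phi> y) - snd w * b (\<phi> y)) / (a (\<phi> y) * d (\<phi> y) - b (\<phi> y) * c (\<phi> y)),
        (snd w * a (\<phi> y) - fst w * c (\<phi> y)) / (a (\<phi> y) * d (\<phi> y) - b (\<phi> y) * c (\<phi> y))))) (at y))"
proof -
  define \<Delta> where "\<Delta> q = a q * d q - b q * c q" for q
  define J where "J x y z w = Blinfun (\<lambda>v::real\<times>real. (fst v * x + snd v * y, fst v * z + snd v * w :: real))"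
    for x y z w
  have J: "blinfun_apply (J x y z w) = (\<lambda>v. (fst v * x + snd v * y, fst v * z + snd v * w))" for x y z w
    unfolding J_def
    by (intro bounded_linear_Blinfun_apply bounded_linear_Pair bounded_linear_add
        bounded_linear_mult_const bounded_linear_fst bounded_linear_snd)
  have cont: "continuous_on U (\<lambda>q. J (a q) (b q) (c q) (d q))"
  proof -
    \<comment> \<open>The matrix is linear in its entries, so its continuity as an operator reduces
      to that of the four entries.\<close>
    have eq: "J x y z w = x *\<^sub>R J 1 0 0 0 + y *\<^sub>R J 0 1 0 0 + z *\<^sub>R J 0 0 1 0 + w *\<^sub>R J 0 0 0 1" for x y z w
      by (rule blinfun_eqI) (simp add: J blinfun.bilinear_simps)
    show ?thesis
      by (subst eq) (intro continuous_intros sm[THEN smooth_continuous])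
  qed
  \<comment> \<open>The left inverse demanded by the inverse function theorem: the adjugate divided
    by the determinant.\<close>
  have inv: "J (d p / \<Delta> p) (- b p / \<Delta> p) (- c p / \<Delta> p) (a p / \<Delta> p) o\<^sub>L J (a p) (b p) (c p) (d p) = id_blinfun"
  proof (rule blinfun_eqI)
    fix v :: "real \<times> real"
    have "((fst v * a p + snd v * b p) * d p - (fst v * c p + snd v * d p) * b p) = fst v * \<Delta> p"
       "((fst v * c p + snd v * d p) * a p - (fst v * a p + snd v * b p) * c p) = snd v * \<Delta> p"
      unfolding \<Delta>_def by algebra+
    then show "blinfun_apply (J (d p / \<Delta> p) (- b p / \<Delta> p) (- c p / \<Delta> p) (a p / \<Delta> p) o\<^sub>L J (a p) (b p) (c p) (d p)) v
        = blinfun_apply id_blinfun v"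
      using nz[OF U(2)]
      by (simp add: J blinfun_compose.rep_eq \<Delta>_def[symmetric] prod_eq_iff diff_divide_distrib[symmetric])
  qed
  have der: "((\<lambda>q. (\<psi>1 q, \<psi>2 q)) has_derivative blinfun_apply (J (a q) (b q) (c q) (d q))) (at q)"
    if "q \<in> U" for q
    unfolding J by (intro has_derivative_Pair d1 d2 that)
  obtain U' V \<phi> \<phi>' where *: "open U'" "U' \<subseteq> U" "p \<in> U'" "open V"
      "homeomorphism U' V (\<lambda>q. (\<psi>1 q, \<psi>2 q)) \<phi>"
      "\<And>y. y \<in> V \<Longrightarrow> (\<phi> has_derivative \<phi>' y) (at y)"
      "\<And>y. y \<in> V \<Longrightarrow> \<phi>' y = Hilbert_Choice.inv (blinfun_apply (J (a (\<phi> y)) (b (\<phi> y)) (c (\<phi> y)) (d (\<phi> y))))"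
      "\<And>y. y \<in> V \<Longrightarrow> bij (blinfun_apply (J (a (\<phi> y)) (b (\<phi> y)) (c (\<phi> y)) (d (\<phi> y))))"
    by (rule inverse_function_theorem[OF U(1) der cont U(2) inv]) blast+
  have \<phi>U: "\<phi> ` V \<subseteq> U'" using *(5) by (auto simp: homeomorphism_def)
  have \<phi>': "(\<phi> has_derivative (\<lambda>w. ((fst w * d (\<phi> y) - snd w * b (\<phi> y)) / \<Delta> (\<phi> y),
        (snd w * a (\<phi> y) - fst w * c (\<phi> y)) / \<Delta> (\<phi> y)))) (at y)" if y: "y \<in> V" for y
  proof -
    have n: "\<Delta> (\<phi> y) \<noteq> 0" using nz[of "\<phi> y"] \<phi>U *(2) y unfolding \<Delta>_def by blast
    have "\<phi>' y w = ((fst w * d (\<phi> y) - snd w * b (\<phi> y)) / \<Delta> (\<phi> y),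
        (snd w * a (\<phi> y) - fst w * c (\<phi> y)) / \<Delta> (\<phi> y))" for w
      unfolding *(7)[OF y]
    proof (rule inv_f_eq[OF bij_is_inj[OF *(8)[OF y]]])
      have "(fst w * d (\<phi> y) - snd w * b (\<phi> y)) * a (\<phi> y) + (snd w * a (\<phi> y) - fst w * c (\<phi> y)) * b (\<phi> y) = fst w * \<Delta> (\<phi> y)"
        "(fst w * d (\<phi> y) - snd w * b (\<phi> y)) * c (\<phi> y) + (snd w * a (\<phi> y) - fst w * c (\<phi> y)) * d (\<phi> y) = snd w * \<Delta> (\<phi> y)"
        unfolding \<Delta>_def by algebra+
      then show "blinfun_apply (J (a (\<phi> y)) (b (\<phi> y)) (c (\<phi> y)) (d (\<phi> y)))
         ((fst w * d (\<phi> y) - snd w * b (\<phi> y)) / \<Delta> (\<phi> y),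
          (snd w * a (\<phi> y) - fst w * c (\<phi> y)) / \<Delta> (\<phi> y)) = w"
        using n by (simp add: J prod_eq_iff add_divide_distrib[symmetric])
    qed
    then show ?thesis using *(6)[OF y] by presburger
  qed
  have s\<phi>: "smooth_on \<phi> V"
  proof (rule smooth_on_bootstrap)
    show "(\<phi> has_derivative (\<lambda>w. ((fst w * d (\<phi> y) - snd w * b (\<phi> y)) / \<Delta> (\<phi> y),
        (snd w * a (\<phi> y) - fst w * c (\<phi> y)) / \<Delta> (\<phi> y)))) (at y within V)" if "y \<in> V" for y
      using \<phi>'[OF that] by (rule has_derivative_at_withinI)
  next
    fix k w assume k: "Ck_on k \<phi> V"
    have "smooth_on (\<lambda>q. ((fst w * d q - snd w * b q) * inverse (\<Delta> q), (snd w * a q - fst w * c q) * inverse (\<Delta> q))) U"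
      unfolding \<Delta>_def
      by (intro smooth_on_Pair smooth_on_mult smooth_on_diff smooth_on_const smooth_on_inverse sm nz)
    then have "Ck_on k (\<lambda>q. ((fst w * d q - snd w * b q) / \<Delta> q, (snd w * a q - fst w * c q) / \<Delta> q)) U"
      by (simp add: smooth_on_def divide_inverse)
    from Ck_on_compose[OF _ this k] \<phi>U *(2)
    show "Ck_on k (\<lambda>y. ((fst w * d (\<phi> y) - snd w * b (\<phi> y)) / \<Delta> (\<phi> y),
        (snd w * a (\<phi> y) - fst w * c (\<phi> y)) / \<Delta> (\<phi> y))) V" by blast
  qed
  have s\<psi>: "smooth_on (\<lambda>q. (\<psi>1 q, \<psi>2 q)) U'"
  proof (rule smooth_onI)
    show "((\<lambda>q. (\<psi>1 q, \<psi>2 q)) has_derivative (\<lambda>w. (fst w * a q + snd w * b q, fst w * c q + snd w * d q))) (at q within U')"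
      if "q \<in> U'" for q
      using that *(2) by (auto intro!: has_derivative_at_withinI[OF has_derivative_Pair] d1 d2)
    show "smooth_on (\<lambda>q. (fst w * a q + snd w * b q, fst w * c q + snd w * d q)) U'" for w
      by (rule smooth_on_subset[OF _ *(2)])
         (intro smooth_on_Pair smooth_on_add smooth_on_mult smooth_on_const sm)
  qed
  have "smooth_diffeo V U' \<phi> (\<lambda>q. (\<psi>1 q, \<psi>2 q))"
    unfolding smooth_diffeo_def using *(1,4) s\<phi> s\<psi> homeomorphism_symD[OF *(5)] by blast
  then show ?thesis
    using *(2,3) \<phi>' unfolding \<Delta>_def by (intro exI conjI ballI)
qed

section \<open>Principal directions\<close>

text \<open>The hypothesis says that \<open>A + k\<close> is singular; a vector orthogonal to a
  nonzero row of it lies in the kernel. The sign of \<open>k\<close> is that of the principal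
  curvatures, the eigenvalues of \<open>- \<gamma>\<close>.\<close>

lemma eigenvector_2:
  fixes A :: "real^2^2"
  assumes "(A$1$1 + k) * (A$2$2 + k) = A$1$2 * A$2$1"
  obtains x where "x \<noteq> 0" "A *v x = (- k) *\<^sub>R x"
proof -
  have ev: "A *v x = (- k) *\<^sub>R x \<longleftrightarrow>
      (A$1$1 + k) * x$1 + A$1$2 * x$2 = 0 \<and> A$2$1 * x$1 + (A$2$2 + k) * x$2 = 0" for x
    by (auto simp: vec_eq_iff forall_2 matrix_vector_mult_def sum_2 algebra_simps)
  have nz: "x \<noteq> 0 \<longleftrightarrow> x$1 \<noteq> 0 \<or> x$2 \<noteq> 0" for x :: "real^2"
    by (simp add: vec_eq_iff forall_2)
  consider "A$1$1 + k \<noteq> 0 \<or> A$1$2 \<noteq> 0" | "A$1$1 + k = 0" "A$1$2 = 0" "A$2$1 \<noteq> 0 \<or> A$2$2 + k \<noteq> 0"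
    | "A$1$1 + k = 0" "A$1$2 = 0" "A$2$1 = 0" "A$2$2 + k = 0" by blast
  then show thesis
  proof cases
    case 1
    then show thesis
      using that[of "vector [A$1$2, - (A$1$1 + k)]"] assms unfolding ev nz by (auto simp: algebra_simps)
  next
    case 2
    then show thesis
      using that[of "vector [A$2$2 + k, - A$2$1]"] unfolding ev nz by (auto simp: algebra_simps)
  next
    case 3
    then show thesis using that[of "vector [1, 0]"] unfolding ev nz by simp
  qed
qed

lemma eigenvectors_independent_2:
  fixes A :: "real^2^2"
  assumes "A *v x = k *\<^sub>R x" "A *v y = m *\<^sub>R y" "k \<noteq> m" "x \<noteq> 0" "y \<noteq> 0"
  shows "x$1 * y$2 - x$2 * y$1 \<noteq> 0"
proof
  assume *: "x$1 * y$2 - x$2 * y$1 = 0"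
  obtain i where i: "x$i \<noteq> 0" using assms(4) by (auto simp: vec_eq_iff)
  have eq: "x$i *\<^sub>R y = y$i *\<^sub>R x"
    using * exhaust_2[of i] by (auto simp: vec_eq_iff forall_2 algebra_simps)
  have "(x$i * m) *\<^sub>R y = A *v (x$i *\<^sub>R y)"
    using assms(2) by (simp add: matrix_vector_mult_scaleR)
  also have "\<dots> = (y$i * k) *\<^sub>R x"
    unfolding eq using assms(1) by (simp add: matrix_vector_mult_scaleR)
  also have "\<dots> = (x$i * k) *\<^sub>R y"
    using arg_cong[OF eq, of "\<lambda>v. k *\<^sub>R v"] by (simp add: mult.commute)
  finally show False using i assms(3,5) by simp
qed

lemma tangent_vec_linear: "linear (tangent_vec z p)"
  unfolding tangent_vec_def by (auto intro!: linearI simp: algebra_simps)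

lemma weingarten_eqs:
  assumes "timelike_surface z l D" "p \<in> D"
  defines "A \<equiv> weingarten_map z l p"
  shows "pd_u l p = A$1$1 *\<^sub>R pd_u z p + A$2$1 *\<^sub>R pd_v z p"
    and "pd_v l p = A$1$2 *\<^sub>R pd_u z p + A$2$2 *\<^sub>R pd_v z p"
  using theI'[OF weingarten_map_ex1[OF assms(1,2)]]
  unfolding A_def weingarten_map_def[symmetric] by blast+

lemma weingarten_tangent_vec:
  assumes "timelike_surface z l D" "p \<in> D"
  shows "tangent_vec z p (weingarten_map z l p *v x) = x$1 *\<^sub>R pd_u l p + x$2 *\<^sub>R pd_v l p"
  unfolding weingarten_eqs[OF assms] tangent_vec_def matrix_vector_mult_def
  by (simp add: sum_2 algebra_simps)

text \<open>Both sides equal \<open>- M\<close>: differentiate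
  \<open>\<langle>l, z\<^sub>u\<rangle> = 0\<close> in v and
  \<open>\<langle>l, z\<^sub>v\<rangle> = 0\<close> in u, and use the symmetry of the second
  derivatives of \<open>z\<close>. Self-adjointness of \<gamma> rests on this.\<close>

lemma weingarten_off_diagonal:
  assumes "timelike_surface z l D" "p \<in> D"
  shows "mink (pd_u l p) (pd_v z p) = mink (pd_v l p) (pd_u z p)"
proof -
  have D: "open D" "smooth_on l D" "smooth_on z D"
    and o: "\<And>q. q \<in> D \<Longrightarrow> mink (l q) (pd_u z q) = 0" "\<And>q. q \<in> D \<Longrightarrow> mink (l q) (pd_v z q) = 0"
    using assms(1) by (auto simp: timelike_surface_def)
  note sl = smooth_pd[OF D(2,1) assms(2)]
  note su = smooth_pd[OF smooth_on_pd(1)[OF D(3,1)] D(1) assms(2)]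
  note sv = smooth_pd[OF smooth_on_pd(2)[OF D(3,1)] D(1) assms(2)]
  have "mink (l p) (pd_v (pd_u z) p) + mink (pd_v l p) (pd_u z p) = 0"
    by (rule pd_mink_const(2)[OF D(1) assms(2) o(1) sl(2) su(2)])
  moreover have "mink (l p) (pd_u (pd_v z) p) + mink (pd_u l p) (pd_v z p) = 0"
    by (rule pd_mink_const(1)[OF D(1) assms(2) o(2) sl(1) sv(1)])
  ultimately show ?thesis using pd_mixed[OF D(3,1) assms(2)] by simp
qed

lemma weingarten_selfadjoint:
  assumes "timelike_surface z l D" "p \<in> D"
  shows "mink (tangent_vec z p (weingarten_map z l p *v x)) (tangent_vec z p y)
    = mink (tangent_vec z p x) (tangent_vec z p (weingarten_map z l p *v y))"
  unfolding weingarten_tangent_vec[OF assms] unfolding tangent_vec_def mink_lin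
  using weingarten_off_diagonal[OF assms] mink_commute
  by (simp add: algebra_simps)

lemma principal_directions:
  assumes "timelike_surface z l D" "diagonalizable_on z l D" "p \<in> D"
  defines "A \<equiv> weingarten_map z l p" and "T \<equiv> tangent_vec z p"
  obtains x y where "A *v x = - nu1 z l p *\<^sub>R x" "A *v y = - nu2 z l p *\<^sub>R y"
    "mink (T x) (T x) < 0" "mink (T y) (T y) > 0" "mink (T x) (T y) = 0"
    "x$1 * y$2 - x$2 * y$1 \<noteq> 0"
proof -
  define H K where "H = mean_curvature z l p" and "K = gauss_curvature z l p"
  have HK: "H = - (1/2) * (A$1$1 + A$2$2)" "K = A$1$1 * A$2$2 - A$1$2 * A$2$1"
    by (simp_all add: H_def K_def mean_curvature_def gauss_curvature_def trace_def sum_2 det_2 A_def)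
  define r where "r = sqrt (H\<^sup>2 - K)"
  have r: "r > 0" "r * r = H\<^sup>2 - K"
    using assms(2,3) by (auto simp: r_def H_def K_def diagonalizable_on_def intro: less_imp_le)
  \<comment> \<open>\<open>- \<gamma>\<close> has trace \<open>2 H\<close> and determinant
    \<open>K\<close>, so its characteristic roots are \<open>H + r\<close> and
    \<open>H - r\<close>.\<close>
  have root: "(A$1$1 + k) * (A$2$2 + k) = A$1$2 * A$2$1" if "k = H + r \<or> k = H - r" for k
  proof -
    have "(k - H) * (k - H) = r * r" using that by auto
    then show ?thesis unfolding r(2) HK power2_eq_square by (simp add: field_simps)
  qed
  obtain x where x: "x \<noteq> 0" "A *v x = (- (H + r)) *\<^sub>R x" using eigenvector_2[OF root] by blast
  obtain y where y: "y \<noteq> 0" "A *v y = (- (H - r)) *\<^sub>R y" using eigenvector_2[OF root] by blast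
  interpret T: linear T unfolding T_def by (rule tangent_vec_linear)
  define \<delta> where "\<delta> = x$1 * y$2 - x$2 * y$1"
  have \<delta>: "\<delta> \<noteq> 0" unfolding \<delta>_def
    using eigenvectors_independent_2[OF x(2) y(2)] x(1) y(1) r(1) by simp
  have o: "mink (T x) (T y) = 0"
  proof -
    have "mink (T (A *v x)) (T y) = mink (T x) (T (A *v y))"
      unfolding T_def A_def by (rule weingarten_selfadjoint[OF assms(1,3)])
    then have "r * mink (T x) (T y) = 0"
      unfolding x y T.scale mink_lin by (simp add: algebra_simps)
    then show ?thesis using r by simp
  qed
  define E F G where "E = mink (pd_u z p) (pd_u z p)" and "F = mink (pd_u z p) (pd_v z p)"
    and "G = mink (pd_v z p) (pd_v z p)"
  have EG: "E < 0" "G > 0"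
    using assms(1,3) by (auto simp: timelike_surface_def coeff_E_def coeff_G_def E_def G_def)
  have T: "mink (T v) (T w) = v$1 * w$1 * E + (v$1 * w$2 + v$2 * w$1) * F + v$2 * w$2 * G" for v w
    unfolding T_def tangent_vec_def mink_lin E_def F_def G_def
    by (simp add: mink_commute[of "pd_v z p" "pd_u z p"] algebra_simps)
  \<comment> \<open>The Gram determinant of \<open>T x\<close>, \<open>T y\<close> is that of
    \<open>z\<^sub>u\<close>, \<open>z\<^sub>v\<close> times \<open>\<delta>\<^sup>2\<close>, hence
    negative. Orthogonality then forces opposite causal characters.\<close>
  have "mink (T x) (T x) * mink (T y) (T y) = (E * G - F * F) * (\<delta> * \<delta>) + mink (T x) (T y) * mink (T x) (T y)"
    unfolding T \<delta>_def by algebra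
  moreover have "E * G - F * F < 0" using mult_neg_pos[OF EG] zero_le_square[of F] by linarith
  moreover have "\<delta> * \<delta> > 0" using \<delta> by (simp add: not_square_less_zero less_le)
  ultimately have neg: "mink (T x) (T x) * mink (T y) (T y) < 0"
    using o mult_neg_pos[of "E * G - F * F" "\<delta> * \<delta>"] by simp
  note result = that
  \<comment> \<open>Which root belongs to the time-like eigenline is not known in advance, so the
    conclusion is proved for arbitrary labels \<open>k\<close>, \<open>m\<close> and then used in
    either order.\<close>
  have key: thesis
    if x: "A *v x = (- k) *\<^sub>R x" and y: "A *v y = (- m) *\<^sub>R y" and km: "k \<noteq> m"
      and sx: "mink (T x) (T x) < 0" and sy: "mink (T y) (T y) > 0" and o: "mink (T x) (T y) = 0"
    for x y k m
  proof -
    have nz: "x \<noteq> 0" "y \<noteq> 0" using sx sy T.zero by (auto simp: mink_def)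
    have "nu1 z l p = k" unfolding nu1_def A_def[symmetric] T_def[symmetric]
    proof (rule the_equality)
      fix k' assume "\<exists>x. mink (T x) (T x) < 0 \<and> A *v x = (- k') *\<^sub>R x"
      then obtain x' where x': "mink (T x') (T x') < 0" "A *v x' = (- k') *\<^sub>R x'" by blast
      show "k' = k"
      proof (rule ccontr)
        assume "k' \<noteq> k"
        have "mink (T (A *v x)) (T x') = mink (T x) (T (A *v x'))"
          unfolding T_def A_def by (rule weingarten_selfadjoint[OF assms(1,3)])
        then have "(k' - k) * mink (T x) (T x') = 0"
          unfolding x x' T.scale mink_lin by (auto simp: algebra_simps)
        then have "mink (T x) (T x') = 0" using \<open>k' \<noteq> k\<close> by simp
        \<comment> \<open>Two orthogonal time-like vectors would have a positive Gram determinant,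
          against the signature of the tangent plane. The same argument settles the space-like case
          below.\<close>
        then have "mink (T x) (T x) * mink (T x') (T x') = (E * G - F * F) * (x$1 * x'$2 - x$2 * x'$1)\<^sup>2"
          unfolding T by algebra
        moreover have "\<dots> \<le> 0" using \<open>E * G - F * F < 0\<close> by (intro mult_nonpos_nonneg) auto
        ultimately show False using mult_neg_neg[OF sx x'(1)] by simp
      qed
    qed (use x sx in blast)
    moreover have "nu2 z l p = m" unfolding nu2_def A_def[symmetric] T_def[symmetric]
    proof (rule the_equality)
      fix k' assume "\<exists>x. mink (T x) (T x) > 0 \<and> A *v x = (- k') *\<^sub>R x"
      then obtain x' where x': "mink (T x') (T x') > 0" "A *v x' = (- k') *\<^sub>R x'" by blast
      show "k' = m"
      proof (rule ccontr)
        assume "k' \<noteq> m"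
        have "mink (T (A *v y)) (T x') = mink (T y) (T (A *v x'))"
          unfolding T_def A_def by (rule weingarten_selfadjoint[OF assms(1,3)])
        then have "(k' - m) * mink (T y) (T x') = 0"
          unfolding y x' T.scale mink_lin by (auto simp: algebra_simps)
        then have "mink (T y) (T x') = 0" using \<open>k' \<noteq> m\<close> by simp
        then have "mink (T y) (T y) * mink (T x') (T x') = (E * G - F * F) * (y$1 * x'$2 - y$2 * x'$1)\<^sup>2"
          unfolding T by algebra
        moreover have "\<dots> \<le> 0" using \<open>E * G - F * F < 0\<close> by (intro mult_nonpos_nonneg) auto
        ultimately show False using mult_pos_pos[OF sy x'(1)] by simp
      qed
    qed (use y sy in blast)
    moreover have "x$1 * y$2 - x$2 * y$1 \<noteq> 0"
      using eigenvectors_independent_2[OF x y] nz km by simp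
    ultimately show thesis using result[OF _ _ sx sy o] x y by simp
  qed
  show thesis
  proof (cases "mink (T x) (T x) < 0")
    case True
    then have "mink (T y) (T y) > 0" using neg by (simp add: mult_less_0_iff)
    then show thesis using key[OF x(2) y(2)] True o r(1) by simp
  next
    case False
    then have "mink (T x) (T x) > 0" "mink (T y) (T y) < 0"
      using neg by (auto simp: mult_less_0_iff)
    then show thesis using key[OF y(2) x(2)] o r(1) by (simp add: mink_commute)
  qed
qed

text \<open>By Cayley-Hamilton, \<open>\<gamma> + \<nu>\<^sub>2\<close> maps into the time-like and \<open>\<gamma> + \<nu>\<^sub>1\<close> into the space-like
  eigenline, which gives eigenvector fields that are smooth without any choice.\<close>

definition frame1 ::
    "(real \<times> real \<Rightarrow> real^3) \<Rightarrow> (real \<times> real \<Rightarrow> real^3) \<Rightarrow> real \<times> real \<Rightarrow> real^3" where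
  "frame1 z l p = pd_u l p + nu2 z l p *\<^sub>R pd_u z p"

definition frame2 ::
    "(real \<times> real \<Rightarrow> real^3) \<Rightarrow> (real \<times> real \<Rightarrow> real^3) \<Rightarrow> real \<times> real \<Rightarrow> real^3" where
  "frame2 z l p = pd_v l p + nu1 z l p *\<^sub>R pd_v z p"

text \<open>Being time-like, \<open>z\<^sub>u\<close> has a nonzero component \<open>s\<close> along
  the time-like eigenvector \<open>e1\<close>. The map \<open>\<gamma> + \<nu>\<^sub>2\<close>
  multiplies this component by \<open>\<nu>\<^sub>2 - \<nu>\<^sub>1\<close> and kills the one along
  \<open>e2\<close>, so \<open>X\<close> is a nonzero multiple of \<open>e1\<close>; likewise
  \<open>Y\<close> of \<open>e2\<close>, starting from \<open>z\<^sub>v\<close>.\<close>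

lemma frame:
  assumes "timelike_surface z l D" "diagonalizable_on z l D" "p \<in> D" "nu1 z l p \<noteq> nu2 z l p"
  defines "X \<equiv> frame1 z l p" and "Y \<equiv> frame2 z l p"
  shows "mink X X < 0" "mink Y Y > 0" "mink X Y = 0"
    and "\<exists>\<alpha> \<beta>. pd_u z p = \<alpha> *\<^sub>R X + \<beta> *\<^sub>R Y \<and>
       pd_u l p = - (nu1 z l p * \<alpha>) *\<^sub>R X - (nu2 z l p * \<beta>) *\<^sub>R Y"
    and "\<exists>\<alpha> \<beta>. pd_v z p = \<alpha> *\<^sub>R X + \<beta> *\<^sub>R Y \<and>
       pd_v l p = - (nu1 z l p * \<alpha>) *\<^sub>R X - (nu2 z l p * \<beta>) *\<^sub>R Y"
proof -
  define a b where "a = nu1 z l p" and "b = nu2 z l p"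
  obtain x y where xy: "weingarten_map z l p *v x = - a *\<^sub>R x" "weingarten_map z l p *v y = - b *\<^sub>R y"
    "mink (tangent_vec z p x) (tangent_vec z p x) < 0" "mink (tangent_vec z p y) (tangent_vec z p y) > 0"
    "mink (tangent_vec z p x) (tangent_vec z p y) = 0"
    "x$1 * y$2 - x$2 * y$1 \<noteq> 0"
    using principal_directions[OF assms(1-3)] unfolding a_def b_def by blast
  define e1 e2 \<delta> where "e1 = tangent_vec z p x" and "e2 = tangent_vec z p y" and "\<delta> = x$1 * y$2 - x$2 * y$1"
  have l: "x$1 *\<^sub>R pd_u l p + x$2 *\<^sub>R pd_v l p = - a *\<^sub>R e1" "y$1 *\<^sub>R pd_u l p + y$2 *\<^sub>R pd_v l p = - b *\<^sub>R e2"
    unfolding weingarten_tangent_vec[OF assms(1,3), symmetric] xy(1,2) e1_def e2_def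
    by (simp_all only: linear_scale[OF tangent_vec_linear])
  have lc: "x$1 * pd_u l p $ i + x$2 * pd_v l p $ i = - a * e1 $ i" "y$1 * pd_u l p $ i + y$2 * pd_v l p $ i = - b * e2 $ i" for i
    using l[THEN arg_cong[where f="\<lambda>v. v $ i"]] by simp_all
  have zc: "e1 $ i = x$1 * pd_u z p $ i + x$2 * pd_v z p $ i" "e2 $ i = y$1 * pd_u z p $ i + y$2 * pd_v z p $ i" for i
    by (simp_all add: e1_def e2_def tangent_vec_def)
  have \<delta>: "\<delta> \<noteq> 0" and e: "mink e1 e1 < 0" "mink e2 e2 > 0" "mink e1 e2 = 0"
    using xy by (simp_all add: \<delta>_def e1_def e2_def)
  \<comment> \<open>The inverse of the coordinate matrix of \<open>e1\<close>, \<open>e2\<close>: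
    these are the components of \<open>z\<^sub>u\<close> and \<open>z\<^sub>v\<close> in the
    eigenbasis.\<close>
  define s t s' t' where "s = y$2 / \<delta>" and "t = - x$2 / \<delta>" and "s' = - y$1 / \<delta>" and "t' = x$1 / \<delta>"
  have \<delta>s: "\<delta> * s = y$2" "\<delta> * t = - x$2" "\<delta> * s' = - y$1" "\<delta> * t' = x$1"
    using \<delta> by (simp_all add: s_def t_def s'_def t'_def)
  have zu: "pd_u z p = s *\<^sub>R e1 + t *\<^sub>R e2" and zv: "pd_v z p = s' *\<^sub>R e1 + t' *\<^sub>R e2"
   and lu: "pd_u l p = - (a * s) *\<^sub>R e1 - (b * t) *\<^sub>R e2" and lv: "pd_v l p = - (a * s') *\<^sub>R e1 - (b * t') *\<^sub>R e2"
  proof -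
    have cramer: "\<delta> * m = \<delta> * (s * (x$1 * m + x$2 * n) + t * (y$1 * m + y$2 * n))"
      "\<delta> * n = \<delta> * (s' * (x$1 * m + x$2 * n) + t' * (y$1 * m + y$2 * n))" for m n
      unfolding distrib_left[of \<delta>] mult.assoc[of \<delta>, symmetric] \<delta>s
      by (simp_all add: \<delta>_def algebra_simps)
    have "\<delta> * pd_u z p $ i = \<delta> * (s * e1 $ i + t * e2 $ i)"
      "\<delta> * pd_v z p $ i = \<delta> * (s' * e1 $ i + t' * e2 $ i)" for i
      unfolding zc by (rule cramer)+
    then show "pd_u z p = s *\<^sub>R e1 + t *\<^sub>R e2" "pd_v z p = s' *\<^sub>R e1 + t' *\<^sub>R e2"
      using \<delta> by (simp_all add: vec_eq_iff)
    have "\<delta> * pd_u l p $ i = \<delta> * (- (a * s) * e1 $ i - b * t * e2 $ i)"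
      "\<delta> * pd_v l p $ i = \<delta> * (- (a * s') * e1 $ i - b * t' * e2 $ i)" for i
      using cramer[where m = "pd_u l p $ i" and n = "pd_v l p $ i"] unfolding lc by (simp_all add: algebra_simps)
    then show "pd_u l p = - (a * s) *\<^sub>R e1 - (b * t) *\<^sub>R e2" "pd_v l p = - (a * s') *\<^sub>R e1 - (b * t') *\<^sub>R e2"
      using \<delta> by (simp_all add: vec_eq_iff)
  qed
  have E: "mink (pd_u z p) (pd_u z p) = s * s * mink e1 e1 + t * t * mink e2 e2"
    and G: "mink (pd_v z p) (pd_v z p) = s' * s' * mink e1 e1 + t' * t' * mink e2 e2"
    unfolding zu zv mink_lin using e(3) mink_commute[of e2 e1] by (simp_all add: algebra_simps)
  have EG: "mink (pd_u z p) (pd_u z p) < 0" "mink (pd_v z p) (pd_v z p) > 0"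
    using assms(1,3) by (auto simp: timelike_surface_def coeff_E_def coeff_G_def)
  have "s \<noteq> 0" using EG(1) e(2) mult_nonneg_nonneg[of "t * t" "mink e2 e2"] unfolding E by fastforce
  have "t' \<noteq> 0" using EG(2) e(1) mult_nonneg_nonpos[of "s' * s'" "mink e1 e1"] unfolding G by fastforce
  define \<xi> \<eta> where "\<xi> = (b - a) * s" and "\<eta> = (a - b) * t'"
  have ab: "a \<noteq> b" using assms(4) by (simp add: a_def b_def)
  have nz: "\<xi> \<noteq> 0" "\<eta> \<noteq> 0"
    using \<open>s \<noteq> 0\<close> \<open>t' \<noteq> 0\<close> ab by (simp_all add: \<xi>_def \<eta>_def)
  have X: "X = \<xi> *\<^sub>R e1"
    unfolding X_def frame1_def b_def[symmetric] lu zu \<xi>_def by (simp add: algebra_simps)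
  have Y: "Y = \<eta> *\<^sub>R e2"
    unfolding Y_def frame2_def a_def[symmetric] lv zv \<eta>_def by (simp add: algebra_simps)
  have sq: "\<xi> * \<xi> > 0" "\<eta> * \<eta> > 0" using nz by (simp_all add: less_le)
  show "mink X X < 0" using mult_pos_neg[OF sq(1) e(1)] by (simp add: X mink_lin mult.assoc)
  show "mink Y Y > 0" using mult_pos_pos[OF sq(2) e(2)] by (simp add: Y mink_lin mult.assoc)
  show "mink X Y = 0" by (simp add: X Y mink_lin e)
  have e': "e1 = (1 / \<xi>) *\<^sub>R X" "e2 = (1 / \<eta>) *\<^sub>R Y" using nz by (simp_all add: X Y)
  show "\<exists>\<alpha> \<beta>. pd_u z p = \<alpha> *\<^sub>R X + \<beta> *\<^sub>R Y \<and>
       pd_u l p = - (nu1 z l p * \<alpha>) *\<^sub>R X - (nu2 z l p * \<beta>) *\<^sub>R Y"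
    unfolding zu lu a_def[symmetric] b_def[symmetric] e'
    by (rule exI[of _ "s / \<xi>"], rule exI[of _ "t / \<eta>"]) simp
  show "\<exists>\<alpha> \<beta>. pd_v z p = \<alpha> *\<^sub>R X + \<beta> *\<^sub>R Y \<and>
       pd_v l p = - (nu1 z l p * \<alpha>) *\<^sub>R X - (nu2 z l p * \<beta>) *\<^sub>R Y"
    unfolding zv lv a_def[symmetric] b_def[symmetric] e'
    by (rule exI[of _ "s' / \<xi>"], rule exI[of _ "t' / \<eta>"]) simp
qed

section \<open>The Codazzi equation and natural parameters\<close>

lemma pd_cong_open:
  assumes "open D" "q \<in> D" "\<And>x. x \<in> D \<Longrightarrow> h x = k x"
  shows "pd_u h q = pd_u k q" "pd_v h q = pd_v k q"
proof -
  have "\<forall>\<^sub>F s in nhds (fst q). (s, snd q) \<in> D" "\<forall>\<^sub>F t in nhds (snd q). (fst q, t) \<in> D"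
    using assms(1,2) by (auto intro!: topological_tendstoD tendsto_eq_intros filterlim_ident)
  then have *: "\<forall>\<^sub>F s in nhds (fst q). h (s, snd q) = k (s, snd q)" "\<forall>\<^sub>F t in nhds (snd q). h (fst q, t) = k (fst q, t)"
    by (auto elim!: eventually_mono intro: assms(3))
  show "pd_u h q = pd_u k q" "pd_v h q = pd_v k q"
    unfolding pd_u_def pd_v_def using * by (auto intro!: vector_derivative_cong_eq)
qed

lemma pd_bilinear:
  assumes "bounded_bilinear b" "smooth_on h D" "smooth_on k D" "open D" "q \<in> D"
  shows "pd_u (\<lambda>x. b (h x) (k x)) q = b (h q) (pd_u k q) + b (pd_u h q) (k q)"
    and "pd_v (\<lambda>x. b (h x) (k x)) q = b (h q) (pd_v k q) + b (pd_v h q) (k q)"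
proof -
  have "((\<lambda>x. b (h x) (k x)) has_derivative
      (\<lambda>w. b (h q) (fst w *\<^sub>R pd_u k q + snd w *\<^sub>R pd_v k q) + b (fst w *\<^sub>R pd_u h q + snd w *\<^sub>R pd_v h q) (k q))) (at q)"
    by (intro bounded_bilinear.FDERIV[OF assms(1)] smooth_on_has_derivative_plane[OF _ assms(4,5)] assms(2,3))
  from pd_eqI[OF this]
  show "pd_u (\<lambda>x. b (h x) (k x)) q = b (h q) (pd_u k q) + b (pd_u h q) (k q)"
    and "pd_v (\<lambda>x. b (h x) (k x)) q = b (h q) (pd_v k q) + b (pd_v h q) (k q)"
    by simp_all
qed

lemmas pd_mink = pd_bilinear[OF mink_bilinear]
lemmas pd_mult = pd_bilinear[OF bounded_bilinear_mult]

text \<open>At an end point of \<open>I\<close> the derivative of \<open>f\<close> is only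
  one-sided. The chain rule still applies because \<nu> takes its values in \<open>I\<close>, and
  openness of \<open>D\<close> makes the result a full derivative.\<close>

lemma pd_chain_within:
  fixes f :: "real \<Rightarrow> real"
  assumes "(f has_real_derivative f') (at (\<nu> q) within I)" "smooth_on \<nu> D" "\<nu> ` D \<subseteq> I" "open D" "q \<in> D"
  shows "pd_u (\<lambda>x. f (\<nu> x)) q = f' * pd_u \<nu> q" "pd_v (\<lambda>x. f (\<nu> x)) q = f' * pd_v \<nu> q"
proof -
  have 1: "(f has_derivative (*) f') (at (\<nu> q) within \<nu> ` D)"
    using assms(1) unfolding has_field_derivative_def by (rule has_derivative_subset) (rule assms(3))
  have 2: "(\<nu> has_derivative (\<lambda>w. fst w *\<^sub>R pd_u \<nu> q + snd w *\<^sub>R pd_v \<nu> q)) (at q within D)"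
    using smooth_on_has_derivative_plane[OF assms(2,4,5)] by (rule has_derivative_at_withinI)
  have "((\<lambda>x. f (\<nu> x)) has_derivative (\<lambda>w. f' * (fst w *\<^sub>R pd_u \<nu> q + snd w *\<^sub>R pd_v \<nu> q))) (at q within D)"
    by (rule has_derivative_in_compose[OF 2 1])
  then have "((\<lambda>x. f (\<nu> x)) has_derivative (\<lambda>w. f' * (fst w *\<^sub>R pd_u \<nu> q + snd w *\<^sub>R pd_v \<nu> q))) (at q)"
    by (simp only: at_within_open[OF assms(5,4)])
  from pd_eqI[OF this] show "pd_u (\<lambda>x. f (\<nu> x)) q = f' * pd_u \<nu> q" "pd_v (\<lambda>x. f (\<nu> x)) q = f' * pd_v \<nu> q"
    by simp_all
qed

text \<open>The Codazzi equation for one principal direction field \<open>X\<close> of constant length, with principal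
  curvature \<open>f \<circ> \<nu>\<close>; \<open>m\<close> is the other principal curvature at \<open>q\<close>, where \<open>\<gamma> + m\<close> has image spanned by \<open>X\<close>.
  With \<open>\<omega> = \<langle>dz, X\<rangle>\<close> it reads \<open>(m - f) d\<omega> = df \<and> \<omega>\<close>, and \<open>e\<^sup>A\<close> is the integrating factor.\<close>

lemma codazzi_closed_form:
  fixes z l X :: "real \<times> real \<Rightarrow> real^3" and \<nu> :: "real \<times> real \<Rightarrow> real" and f A :: "real \<Rightarrow> real"
  assumes D: "open D" "q \<in> D" and sm: "smooth_on z D" "smooth_on l D" "smooth_on X D"
    and \<nu>: "smooth_on \<nu> D" "\<nu> ` D \<subseteq> I" and fA: "smooth_on f I" "smooth_on A I"
    and df: "(f has_real_derivative f') (at (\<nu> q) within I)"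
    and dA: "(A has_real_derivative f' / (f (\<nu> q) - m)) (at (\<nu> q) within I)"
    and m: "f (\<nu> q) \<noteq> m"
    and X: "\<And>x. x \<in> D \<Longrightarrow> mink (X x) (X x) = c"
    and lX: "\<And>x. x \<in> D \<Longrightarrow> mink (pd_u l x) (X x) = - f (\<nu> x) * mink (pd_u z x) (X x)"
      "\<And>x. x \<in> D \<Longrightarrow> mink (pd_v l x) (X x) = - f (\<nu> x) * mink (pd_v z x) (X x)"
    and par: "pd_u l q + m *\<^sub>R pd_u z q = r *\<^sub>R X q" "pd_v l q + m *\<^sub>R pd_v z q = s *\<^sub>R X q"
  shows "pd_v (\<lambda>x. exp (A (\<nu> x)) * mink (pd_u z x) (X x)) q
       = pd_u (\<lambda>x. exp (A (\<nu> x)) * mink (pd_v z x) (X x)) q"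
proof -
  note zu = smooth_on_pd(1)[OF sm(1) D(1)] and zv = smooth_on_pd(2)[OF sm(1) D(1)]
  note lu = smooth_on_pd(1)[OF sm(2) D(1)] and lv = smooth_on_pd(2)[OF sm(2) D(1)]
  define P Q where "P = (\<lambda>x. mink (pd_u z x) (X x))" and "Q = (\<lambda>x. mink (pd_v z x) (X x))"
  have PQ: "smooth_on P D" "smooth_on Q D"
    unfolding P_def Q_def by (intro smooth_on_mink zu zv sm(3))+
  have fs: "smooth_on (\<lambda>x. - f (\<nu> x)) D" and As: "smooth_on (\<lambda>x. A (\<nu> x)) D"
    by (intro smooth_on_uminus smooth_on_compose[OF fA(1) \<nu>] smooth_on_compose[OF fA(2) \<nu>])+
  then have es: "smooth_on (\<lambda>x. exp (A (\<nu> x))) D"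
    by (intro smooth_on_compose[OF smooth_on_exp]) auto
  \<comment> \<open>The term with the mixed derivative of \<open>z\<close> is common to
    \<open>pd_v P\<close> and \<open>pd_u Q\<close> and cancels in their difference.\<close>
  have dP: "pd_v P q = mink (pd_u z q) (pd_v X q) + mink (pd_v (pd_u z) q) (X q)"
    unfolding P_def by (rule pd_mink(2)[OF zu sm(3) D])
  have dQ: "pd_u Q q = mink (pd_v z q) (pd_u X q) + mink (pd_v (pd_u z) q) (X q)"
    unfolding Q_def pd_mixed[OF sm(1) D, symmetric] by (rule pd_mink(1)[OF zv sm(3) D])
  have dX: "mink (X q) (pd_u X q) = 0" "mink (X q) (pd_v X q) = 0"
    using pd_mink_const(1)[OF D X smooth_pd(1)[OF sm(3) D] smooth_pd(1)[OF sm(3) D]]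
      pd_mink_const(2)[OF D X smooth_pd(2)[OF sm(3) D] smooth_pd(2)[OF sm(3) D]] mink_commute by simp_all
  have df': "pd_u (\<lambda>x. - f (\<nu> x)) q = - f' * pd_u \<nu> q" "pd_v (\<lambda>x. - f (\<nu> x)) q = - f' * pd_v \<nu> q"
    using pd_chain_within[OF DERIV_minus[OF df] \<nu> D] by simp_all
  \<comment> \<open>The eigenvalue equation for \<open>l\<^sub>u\<close> is differentiated in v, the
    one for \<open>l\<^sub>v\<close> below in u; subtracting the two eliminates the second
    derivative of \<open>l\<close>.\<close>
  have "mink (pd_u l q) (pd_v X q) + mink (pd_v (pd_u l) q) (X q) = pd_v (\<lambda>x. - f (\<nu> x) * P x) q"
    using pd_mink(2)[OF lu sm(3) D] pd_cong_open(2)[OF D, of "\<lambda>x. mink (pd_u l x) (X x)" "\<lambda>x. - f (\<nu> x) * P x"] lX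
    unfolding P_def by simp
  also have "\<dots> = - f (\<nu> q) * pd_v P q - f' * pd_v \<nu> q * P q"
    using pd_mult(2)[OF fs PQ(1) D] df' by simp
  finally have 1: "mink (pd_u l q) (pd_v X q) + mink (pd_v (pd_u l) q) (X q)
      = - f (\<nu> q) * pd_v P q - f' * pd_v \<nu> q * P q" .
  have "mink (pd_v l q) (pd_u X q) + mink (pd_v (pd_u l) q) (X q) = pd_u (\<lambda>x. - f (\<nu> x) * Q x) q"
    using pd_mink(1)[OF lv sm(3) D] pd_cong_open(1)[OF D, of "\<lambda>x. mink (pd_v l x) (X x)" "\<lambda>x. - f (\<nu> x) * Q x"] lX
      pd_mixed[OF sm(2) D]
    unfolding Q_def by simp
  also have "\<dots> = - f (\<nu> q) * pd_u Q q - f' * pd_u \<nu> q * Q q"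
    using pd_mult(1)[OF fs PQ(2) D] df' by simp
  finally have 2: "mink (pd_v l q) (pd_u X q) + mink (pd_v (pd_u l) q) (X q)
      = - f (\<nu> q) * pd_u Q q - f' * pd_u \<nu> q * Q q" .
  \<comment> \<open>Modulo \<open>X\<close>, the derivatives of \<open>l\<close> are
    \<open>- m\<close> times those of \<open>z\<close>. Since \<open>X\<close> has constant length
    it is orthogonal to its own derivatives, and the \<open>X\<close> terms drop out.\<close>
  have "pd_u l q = r *\<^sub>R X q - m *\<^sub>R pd_u z q" "pd_v l q = s *\<^sub>R X q - m *\<^sub>R pd_v z q"
    using par by (simp_all add: algebra_simps)
  then have 3: "mink (pd_u l q) (pd_v X q) = - m * mink (pd_u z q) (pd_v X q)"
    "mink (pd_v l q) (pd_u X q) = - m * mink (pd_v z q) (pd_u X q)"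
    by (simp_all add: mink_lin dX)
  have codazzi: "f' * pd_u \<nu> q * Q q - f' * pd_v \<nu> q * P q = (m - f (\<nu> q)) * (pd_u Q q - pd_v P q)"
    using 1 2 unfolding 3 dP dQ by algebra
  define a where "a = f' / (f (\<nu> q) - m)"
  have f': "f' = a * (f (\<nu> q) - m)" using m by (simp add: a_def)
  have "(f (\<nu> q) - m) * (a * pd_u \<nu> q * Q q + pd_u Q q) = (f (\<nu> q) - m) * (a * pd_v \<nu> q * P q + pd_v P q)"
    using codazzi unfolding f' by algebra
  then have key: "a * pd_u \<nu> q * Q q + pd_u Q q = a * pd_v \<nu> q * P q + pd_v P q"
    using m by simp
  have "((\<lambda>t. exp (A t)) has_real_derivative exp (A (\<nu> q)) * a) (at (\<nu> q) within I)"
    using DERIV_fun_exp dA unfolding a_def by (auto intro!: derivative_eq_intros)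
  note de = pd_chain_within[OF this \<nu> D]
  have "pd_v (\<lambda>x. exp (A (\<nu> x)) * P x) q = exp (A (\<nu> q)) * (a * pd_v \<nu> q * P q + pd_v P q)"
    unfolding pd_mult(2)[OF es PQ(1) D] de by (simp add: algebra_simps)
  also have "\<dots> = pd_u (\<lambda>x. exp (A (\<nu> x)) * Q x) q"
    unfolding pd_mult(1)[OF es PQ(2) D] de key[symmetric] by (simp add: algebra_simps)
  finally show ?thesis unfolding P_def Q_def .
qed

text \<open>The lengths of \<open>frame1\<close> and \<open>frame2\<close> never vanish on
  \<open>D\<close>, so normalizing preserves smoothness. The signs of the \<open>X\<close> terms
  come from \<open>\<langle>X, X\<rangle> = -1\<close>.\<close>

lemma unit_principal_frame:
  assumes tl: "timelike_surface z l D" and dg: "diagonalizable_on z l D"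
    and ws: "weingarten_surface z l D I f g \<nu>"
  obtains X Y where "smooth_on X D" "smooth_on Y D"
    and "\<And>q. q \<in> D \<Longrightarrow> mink (X q) (X q) = -1" "\<And>q. q \<in> D \<Longrightarrow> mink (Y q) (Y q) = 1"
      "\<And>q. q \<in> D \<Longrightarrow> mink (X q) (Y q) = 0"
    and "\<And>q. q \<in> D \<Longrightarrow> pd_u z q = - mink (pd_u z q) (X q) *\<^sub>R X q + mink (pd_u z q) (Y q) *\<^sub>R Y q"
      "\<And>q. q \<in> D \<Longrightarrow> pd_v z q = - mink (pd_v z q) (X q) *\<^sub>R X q + mink (pd_v z q) (Y q) *\<^sub>R Y q"
      "\<And>q. q \<in> D \<Longrightarrow> pd_u l q = (f (\<nu> q) * mink (pd_u z q) (X q)) *\<^sub>R X q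
          - (g (\<nu> q) * mink (pd_u z q) (Y q)) *\<^sub>R Y q"
      "\<And>q. q \<in> D \<Longrightarrow> pd_v l q = (f (\<nu> q) * mink (pd_v z q) (X q)) *\<^sub>R X q
          - (g (\<nu> q) * mink (pd_v z q) (Y q)) *\<^sub>R Y q"
proof -
  have D: "open D" "smooth_on z D" "smooth_on l D" using tl by (auto simp: timelike_surface_def)
  have \<nu>: "smooth_on \<nu> D" "\<nu> ` D \<subseteq> I" "smooth_on f I" "smooth_on g I"
    using ws by (auto simp: weingarten_surface_def)
  have nu: "nu1 z l q = f (\<nu> q)" "nu2 z l q = g (\<nu> q)" "f (\<nu> q) \<noteq> g (\<nu> q)" if "q \<in> D" for q
    using ws that by (auto simp: weingarten_surface_def)
  define W1 W2 where "W1 = frame1 z l" and "W2 = frame2 z l"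
  have fr: "mink (W1 q) (W1 q) < 0" "mink (W2 q) (W2 q) > 0" "mink (W1 q) (W2 q) = 0"
    "\<exists>\<alpha> \<beta>. pd_u z q = \<alpha> *\<^sub>R W1 q + \<beta> *\<^sub>R W2 q \<and>
       pd_u l q = - (f (\<nu> q) * \<alpha>) *\<^sub>R W1 q - (g (\<nu> q) * \<beta>) *\<^sub>R W2 q"
    "\<exists>\<alpha> \<beta>. pd_v z q = \<alpha> *\<^sub>R W1 q + \<beta> *\<^sub>R W2 q \<and>
       pd_v l q = - (f (\<nu> q) * \<alpha>) *\<^sub>R W1 q - (g (\<nu> q) * \<beta>) *\<^sub>R W2 q" if q: "q \<in> D" for q
    using frame[OF tl dg q] unfolding nu[OF q] W1_def W2_def using nu(3)[OF q] by blast+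
  have sW: "smooth_on W1 D" "smooth_on W2 D"
  proof -
    \<comment> \<open>On \<open>D\<close> the descriptions \<open>nu1\<close>, \<open>nu2\<close>
      coincide with f and g composed with \<nu>; this is the source of the smoothness of the
      frame.\<close>
    have "smooth_on (\<lambda>q. pd_u l q + g (\<nu> q) *\<^sub>R pd_u z q) D" "smooth_on (\<lambda>q. pd_v l q + f (\<nu> q) *\<^sub>R pd_v z q) D"
      by (intro smooth_on_add smooth_on_scaleR smooth_on_pd D
          smooth_on_compose[OF \<nu>(3,1,2)] smooth_on_compose[OF \<nu>(4,1,2)])+
    then show "smooth_on W1 D" "smooth_on W2 D"
      using smooth_on_cong[of D W1 "\<lambda>q. pd_u l q + g (\<nu> q) *\<^sub>R pd_u z q"]
        smooth_on_cong[of D W2 "\<lambda>q. pd_v l q + f (\<nu> q) *\<^sub>R pd_v z q"] nu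
      by (auto simp: W1_def W2_def frame1_def frame2_def)
  qed
  define n1 n2 where "n1 q = sqrt (- mink (W1 q) (W1 q))" and "n2 q = sqrt (mink (W2 q) (W2 q))" for q
  have n: "n1 q > 0" "n1 q * n1 q = - mink (W1 q) (W1 q)" "n2 q > 0" "n2 q * n2 q = mink (W2 q) (W2 q)"
    if "q \<in> D" for q using fr(1,2)[OF that] by (simp_all add: n1_def n2_def)
  define X Y where "X q = inverse (n1 q) *\<^sub>R W1 q" and "Y q = inverse (n2 q) *\<^sub>R W2 q" for q
  have W: "W1 q = n1 q *\<^sub>R X q" "W2 q = n2 q *\<^sub>R Y q" if "q \<in> D" for q
    using n(1,3)[OF that] by (simp_all add: X_def Y_def)
  have sn: "smooth_on n1 D" "smooth_on n2 D"
    unfolding n1_def n2_def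
    using fr(1,2) by (auto intro!: smooth_on_compose[OF smooth_on_sqrt smooth_on_uminus[OF smooth_on_mink]]
        smooth_on_compose[OF smooth_on_sqrt smooth_on_mink] sW)
  show thesis
  proof
    show "smooth_on X D" "smooth_on Y D"
      unfolding X_def Y_def by (intro smooth_on_scaleR smooth_on_inverse sn sW; use n(1,3) in fastforce)+
    show XX: "mink (X q) (X q) = -1" and YY: "mink (Y q) (Y q) = 1" and XY: "mink (X q) (Y q) = 0" if q: "q \<in> D" for q
      using n[OF q] fr(1-3)[OF q] unfolding X_def Y_def mink_lin
      by (simp_all add: field_simps)
    have *: "v = - mink v (X q) *\<^sub>R X q + mink v (Y q) *\<^sub>R Y q \<and>
        w = (f (\<nu> q) * mink v (X q)) *\<^sub>R X q - (g (\<nu> q) * mink v (Y q)) *\<^sub>R Y q"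
      if q: "q \<in> D" and ex: "\<exists>\<alpha> \<beta>. v = \<alpha> *\<^sub>R W1 q + \<beta> *\<^sub>R W2 q \<and>
       w = - (f (\<nu> q) * \<alpha>) *\<^sub>R W1 q - (g (\<nu> q) * \<beta>) *\<^sub>R W2 q" for q v w
    proof -
      obtain \<alpha> \<beta> where v: "v = \<alpha> *\<^sub>R W1 q + \<beta> *\<^sub>R W2 q"
        and w: "w = - (f (\<nu> q) * \<alpha>) *\<^sub>R W1 q - (g (\<nu> q) * \<beta>) *\<^sub>R W2 q" using ex by blast
      have v': "v = (\<alpha> * n1 q) *\<^sub>R X q + (\<beta> * n2 q) *\<^sub>R Y q"
        and w': "w = - (f (\<nu> q) * (\<alpha> * n1 q)) *\<^sub>R X q - (g (\<nu> q) * (\<beta> * n2 q)) *\<^sub>R Y q"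
        unfolding v w W[OF q] by (simp_all add: mult.assoc)
      have c: "\<alpha> * n1 q = - mink v (X q)" "\<beta> * n2 q = mink v (Y q)"
        unfolding v' mink_lin using XX[OF q] YY[OF q] XY[OF q] mink_commute[of "Y q" "X q"] by simp_all
      show ?thesis
        by (intro conjI) (use v' w' in \<open>simp_all only: c mult_minus_right minus_minus\<close>)
    qed
    show "pd_u z q = - mink (pd_u z q) (X q) *\<^sub>R X q + mink (pd_u z q) (Y q) *\<^sub>R Y q"
      "pd_v z q = - mink (pd_v z q) (X q) *\<^sub>R X q + mink (pd_v z q) (Y q) *\<^sub>R Y q"
      "pd_u l q = (f (\<nu> q) * mink (pd_u z q) (X q)) *\<^sub>R X q - (g (\<nu> q) * mink (pd_u z q) (Y q)) *\<^sub>R Y q"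
      "pd_v l q = (f (\<nu> q) * mink (pd_v z q) (X q)) *\<^sub>R X q - (g (\<nu> q) * mink (pd_v z q) (Y q)) *\<^sub>R Y q"
      if q: "q \<in> D" for q
      using *[OF q fr(4)[OF q]] *[OF q fr(5)[OF q]] by blast+
  qed
qed

text \<open>A criterion in terms of \<open>dz\<close> and \<open>dl\<close> only: differentiating
  \<open>\<langle>l, z\<^sub>u\<rangle> = \<langle>l, z\<^sub>v\<rangle> = 0\<close> turns the
  diagonal form of \<open>dl\<close> into \<open>L\<close>, \<open>M\<close>, \<open>N\<close>, and
  these give the principal curvatures.\<close>

lemma natural_principal_paramsI:
  fixes z l :: "real \<times> real \<Rightarrow> real^3" and \<nu> :: "real \<times> real \<Rightarrow> real" and f g A B :: "real \<Rightarrow> real"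
  assumes V: "open V" "smooth_on z V" "smooth_on l V" "smooth_on \<nu> V" "\<nu> ` V \<subseteq> I"
    and I: "is_interval I" "interior I \<noteq> {}" "smooth_on f I" "smooth_on g I"
      "\<And>t. t \<in> I \<Longrightarrow> f t - g t \<noteq> 0 \<and> deriv_within f I t * deriv_within g I t \<noteq> 0"
    and AB: "\<And>t. t \<in> I \<Longrightarrow> (A has_real_derivative deriv_within f I t / (f t - g t)) (at t within I)"
      "\<And>t. t \<in> I \<Longrightarrow> (B has_real_derivative deriv_within g I t / (g t - f t)) (at t within I)"
    and l: "\<And>p. p \<in> V \<Longrightarrow> mink (l p) (l p) = 1" "\<And>p. p \<in> V \<Longrightarrow> mink (l p) (pd_u z p) = 0"
      "\<And>p. p \<in> V \<Longrightarrow> mink (l p) (pd_v z p) = 0"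
    and EFG: "\<And>p. p \<in> V \<Longrightarrow> mink (pd_u z p) (pd_u z p) = - (exp (- A (\<nu> p)))\<^sup>2"
      "\<And>p. p \<in> V \<Longrightarrow> mink (pd_u z p) (pd_v z p) = 0"
      "\<And>p. p \<in> V \<Longrightarrow> mink (pd_v z p) (pd_v z p) = (exp (- B (\<nu> p)))\<^sup>2"
    and dl: "\<And>p. p \<in> V \<Longrightarrow> pd_u l p = - f (\<nu> p) *\<^sub>R pd_u z p"
      "\<And>p. p \<in> V \<Longrightarrow> pd_v l p = - g (\<nu> p) *\<^sub>R pd_v z p"
  shows "natural_principal_params z l V I f g \<nu>"
proof -
  have EG: "coeff_E z p < 0" "coeff_G z p > 0" "coeff_E z p = - (exp (- A (\<nu> p)))\<^sup>2"
     "coeff_G z p = (exp (- B (\<nu> p)))\<^sup>2" if "p \<in> V" for p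
    using EFG[OF that] by (simp_all add: coeff_E_def coeff_G_def)
  have tl: "timelike_surface z l V" using V l EG by (simp add: timelike_surface_def)
  have 2: "coeff_L z l p = f (\<nu> p) * coeff_E z p" "coeff_N z l p = g (\<nu> p) * coeff_G z p"
      "coeff_M z l p = 0" if p: "p \<in> V" for p
  proof -
    note sl = smooth_pd[OF V(3,1) p]
    note su = smooth_pd[OF smooth_on_pd(1)[OF V(2,1)] V(1) p]
    note sv = smooth_pd[OF smooth_on_pd(2)[OF V(2,1)] V(1) p]
    show "coeff_L z l p = f (\<nu> p) * coeff_E z p"
      using pd_mink_const(1)[OF V(1) p l(2) sl(1) su(1)]
      unfolding dl[OF p] mink_lin by (simp add: coeff_L_def coeff_E_def)
    show "coeff_N z l p = g (\<nu> p) * coeff_G z p"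
      using pd_mink_const(2)[OF V(1) p l(3) sl(2) sv(2)]
      unfolding dl[OF p] mink_lin by (simp add: coeff_N_def coeff_G_def)
    show "coeff_M z l p = 0"
      using pd_mink_const(2)[OF V(1) p l(2) sl(2) su(2)] EFG(2)[OF p]
      unfolding dl[OF p] mink_lin by (simp add: coeff_M_def mink_commute[of "pd_v z p"])
  qed
  have pp: "principal_params z l V"
    using tl EFG(2) 2(3) by (simp add: principal_params_def coeff_F_def)
  have nu: "nu1 z l p = f (\<nu> p)" "nu2 z l p = g (\<nu> p)" if "p \<in> V" for p
    using principal_curvatures_principal_params[OF pp that] 2[OF that] EG(1,2)[OF that] by simp_all
  have "diagonalizable_on z l V" unfolding diagonalizable_on_def
  proof
    fix p assume p: "p \<in> V"
    define A where "A = weingarten_map z l p"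
    define E G where "E = mink (pd_u z p) (pd_u z p)" and "G = mink (pd_v z p) (pd_v z p)"
    have EG: "E \<noteq> 0" "G \<noteq> 0" using EFG[OF p] by (simp_all add: E_def G_def)
    have F: "mink (pd_u z p) (pd_v z p) = 0" "mink (pd_v z p) (pd_u z p) = 0"
      using EFG(2)[OF p] mink_commute by simp_all
    have w: "- f (\<nu> p) *\<^sub>R pd_u z p = A$1$1 *\<^sub>R pd_u z p + A$2$1 *\<^sub>R pd_v z p"
      "- g (\<nu> p) *\<^sub>R pd_v z p = A$1$2 *\<^sub>R pd_u z p + A$2$2 *\<^sub>R pd_v z p"
      using weingarten_eqs[OF tl p] unfolding dl[OF p] A_def by simp_all
    have "A$1$1 * E = - f (\<nu> p) * E" "A$2$1 * G = 0" "A$2$2 * G = - g (\<nu> p) * G" "A$1$2 * E = 0"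
      using arg_cong[OF w(1), of "\<lambda>v. mink v (pd_u z p)"] arg_cong[OF w(1), of "\<lambda>v. mink v (pd_v z p)"]
        arg_cong[OF w(2), of "\<lambda>v. mink v (pd_v z p)"] arg_cong[OF w(2), of "\<lambda>v. mink v (pd_u z p)"]
      unfolding mink_lin F E_def[symmetric] G_def[symmetric] by simp_all
    then have A: "A$1$1 = - f (\<nu> p)" "A$2$1 = 0" "A$1$2 = 0" "A$2$2 = - g (\<nu> p)"
      using EG by (simp_all only: mult_cancel_right mult_eq_0_iff simp_thms)
    \<comment> \<open>Here \<gamma> is diagonal with entries \<open>- f\<close> and
      \<open>- g\<close>, so \<open>H\<close> is the mean and \<open>K\<close> the product of f and
      g.\<close>
    have "(mean_curvature z l p)\<^sup>2 - gauss_curvature z l p = ((f (\<nu> p) - g (\<nu> p)) / 2)\<^sup>2"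
      unfolding mean_curvature_def gauss_curvature_def trace_def sum_2 det_2 A_def[symmetric] A
      by (simp add: power2_eq_square field_simps)
    also have "\<dots> > 0" using I(5) V(5) p by auto
    finally show "0 < (mean_curvature z l p)\<^sup>2 - gauss_curvature z l p" .
  qed
  moreover have "weingarten_surface z l V I f g \<nu>"
    unfolding weingarten_surface_def using I V nu by blast
  moreover have "sqrt (- coeff_E z p) * exp (A (\<nu> p)) = 1" "sqrt (coeff_G z p) * exp (B (\<nu> p)) = 1"
    if "p \<in> V" for p unfolding EG(3,4)[OF that] by (simp_all add: exp_minus)
  ultimately show ?thesis
    unfolding natural_principal_params_def constant_on_def using pp AB by blast
qed

lemma smooth_interval_antiderivative:
  fixes h :: "real \<Rightarrow> real"
  assumes "is_interval I" "smooth_on h I"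
  shows "\<exists>A. (\<forall>t\<in>I. (A has_real_derivative h t) (at t within I)) \<and> smooth_on A I"
proof -
  obtain A where A: "\<And>t. t \<in> I \<Longrightarrow> (A has_real_derivative h t) (at t within I)"
    using interval_antiderivative[OF assms(1) smooth_continuous[OF assms(2)]] by blast
  moreover have "smooth_on A I"
    by (rule smooth_onI[OF A[unfolded has_field_derivative_def]])
       (auto intro: smooth_on_mult smooth_on_const assms(2))
  ultimately show ?thesis by blast
qed

lemma open_contains_rectangle:
  fixes p :: "real \<times> real"
  assumes "open D" "p \<in> D"
  obtains a b c d where "p \<in> {a<..<b} \<times> {c<..<d}" "{a..b} \<times> {c..d} \<subseteq> D"
proof -
  obtain S T where ST: "open S" "open T" "p \<in> S \<times> T" "S \<times> T \<subseteq> D"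
    using open_prod_elim[OF assms] by metis
  obtain a b where "cbox a b \<subseteq> S" "fst p \<in> box a b"
    using open_contains_cbox[OF ST(1), of "fst p"] ST(3) by (auto simp: mem_Times_iff)
  moreover obtain c d where "cbox c d \<subseteq> T" "snd p \<in> box c d"
    using open_contains_cbox[OF ST(2), of "snd p"] ST(3) by (auto simp: mem_Times_iff)
  ultimately show thesis
    using ST(4) by (intro that[of a b c d]) (auto simp: mem_Times_iff)
qed

text \<open>Multiplies the partials in the old parameters by the inverse Jacobian. The weights
  \<open>\<alpha>\<close>, \<open>\<beta>\<close> allow one computation for both differentials: they
  are -1, 1 for \<open>dz\<close> and f, -g for \<open>dl\<close>.\<close>

lemma dual_frame:
  fixes X Y u v :: "'a::real_vector"
  assumes u: "u = (\<alpha> * P) *\<^sub>R X + (\<beta> * R) *\<^sub>R Y" and v: "v = (\<alpha> * Q) *\<^sub>R X + (\<beta> * S) *\<^sub>R Y"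
    and e: "e \<noteq> 0" "e' \<noteq> 0" and \<Delta>: "\<Delta> = e * P * (e' * S) - e * Q * (e' * R)" "\<Delta> \<noteq> 0"
  shows "(e' * S / \<Delta>) *\<^sub>R u + (- (e' * R) / \<Delta>) *\<^sub>R v = (\<alpha> / e) *\<^sub>R X"
    and "(- (e * Q) / \<Delta>) *\<^sub>R u + (e * P / \<Delta>) *\<^sub>R v = (\<beta> / e') *\<^sub>R Y"
proof -
  have "e' * S / \<Delta> * (\<alpha> * P) + - (e' * R) / \<Delta> * (\<alpha> * Q) = \<alpha> / e"
    "e' * S / \<Delta> * (\<beta> * R) + - (e' * R) / \<Delta> * (\<beta> * S) = 0"
    "- (e * Q) / \<Delta> * (\<alpha> * P) + e * P / \<Delta> * (\<alpha> * Q) = 0"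
    "- (e * Q) / \<Delta> * (\<beta> * R) + e * P / \<Delta> * (\<beta> * S) = \<beta> / e'"
    using e \<Delta>(2) by (simp_all add: field_simps) (simp_all add: \<Delta>(1) algebra_simps)
  moreover have "s *\<^sub>R u + t *\<^sub>R v = (s * (\<alpha> * P) + t * (\<alpha> * Q)) *\<^sub>R X + (s * (\<beta> * R) + t * (\<beta> * S)) *\<^sub>R Y"
    for s t unfolding u v by (simp add: algebra_simps)
  ultimately show "(e' * S / \<Delta>) *\<^sub>R u + (- (e' * R) / \<Delta>) *\<^sub>R v = (\<alpha> / e) *\<^sub>R X"
    and "(- (e * Q) / \<Delta>) *\<^sub>R u + (e * P / \<Delta>) *\<^sub>R v = (\<beta> / e') *\<^sub>R Y"
    by (simp_all only: scaleR_zero_left add_0_left add_0_right)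
qed

lemma pd_compose_plane:
  fixes \<phi> :: "real \<times> real \<Rightarrow> real \<times> real"
  assumes "smooth_on h D" "open D" "\<phi> y \<in> D"
    and "(\<phi> has_derivative (\<lambda>w. ((fst w * d - snd w * b) / \<Delta>, (snd w * a - fst w * c) / \<Delta>))) (at y)"
  shows "pd_u (h \<circ> \<phi>) y = (d / \<Delta>) *\<^sub>R pd_u h (\<phi> y) + (- c / \<Delta>) *\<^sub>R pd_v h (\<phi> y)"
    and "pd_v (h \<circ> \<phi>) y = (- b / \<Delta>) *\<^sub>R pd_u h (\<phi> y) + (a / \<Delta>) *\<^sub>R pd_v h (\<phi> y)"
  using pd_eqI[OF diff_chain_at[OF assms(4) smooth_on_has_derivative_plane[OF assms(1-3)]]]
  by simp_all

lemma smooth_on_compose_o: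
  "smooth_on h S \<Longrightarrow> smooth_on g T \<Longrightarrow> g ` T \<subseteq> S \<Longrightarrow> smooth_on (h \<circ> g) T"
  unfolding comp_def by (rule smooth_on_compose)

theorem proposition3p3:
  fixes z l :: "real \<times> real \<Rightarrow> real^3" and D :: "(real \<times> real) set"
    and I :: "real set" and f g :: "real \<Rightarrow> real" and \<nu> :: "real \<times> real \<Rightarrow> real"
  assumes "timelike_surface z l D"
    and "diagonalizable_on z l D"
    and "weingarten_surface z l D I f g \<nu>"
  shows "\<forall>p\<in>D. \<exists>U V \<phi> \<psi>. p \<in> U \<and> U \<subseteq> D \<and> smooth_diffeo V U \<phi> \<psi> \<and>
           natural_principal_params (z \<circ> \<phi>) (l \<circ> \<phi>) V I f g (\<nu> \<circ> \<phi>)"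
proof
  fix p assume p: "p \<in> D"
  have D: "open D" and z: "smooth_on z D" and l: "smooth_on l D"
    using assms(1) by (auto simp: timelike_surface_def)
  have ll: "mink (l q) (l q) = 1" "mink (l q) (pd_u z q) = 0" "mink (l q) (pd_v z q) = 0"
    and EG: "mink (pd_u z q) (pd_u z q) < 0" "mink (pd_v z q) (pd_v z q) > 0" if "q \<in> D" for q
    using assms(1) that by (auto simp: timelike_surface_def coeff_E_def coeff_G_def)
  have I: "is_interval I" "interior I \<noteq> {}" and f: "smooth_on f I" and g: "smooth_on g I"
    and \<nu>: "smooth_on \<nu> D" "\<nu> ` D \<subseteq> I"
    using assms(3) by (auto simp: weingarten_surface_def)
  have fg: "f t - g t \<noteq> 0" "g t - f t \<noteq> 0" "deriv_within f I t * deriv_within g I t \<noteq> 0" if "t \<in> I" for t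
    using assms(3) that by (auto simp: weingarten_surface_def)
  have \<nu>I: "\<nu> q \<in> I" if "q \<in> D" for q using \<nu>(2) that by blast
  note df = smooth_on_deriv_within[OF f I] and dg = smooth_on_deriv_within[OF g I]
  have quot: "smooth_on (\<lambda>t. deriv_within f I t / (f t - g t)) I" "smooth_on (\<lambda>t. deriv_within g I t / (g t - f t)) I"
    unfolding divide_inverse
    by (intro smooth_on_mult smooth_on_inverse smooth_on_diff df(2) dg(2) f g fg(1,2); assumption)+
  from smooth_interval_antiderivative[OF I(1) quot(1)] obtain A where
    A: "\<forall>t\<in>I. (A has_real_derivative deriv_within f I t / (f t - g t)) (at t within I)"
    and sA: "smooth_on A I" by blast
  from smooth_interval_antiderivative[OF I(1) quot(2)] obtain B where
    B: "\<forall>t\<in>I. (B has_real_derivative deriv_within g I t / (g t - f t)) (at t within I)"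
    and sB: "smooth_on B I" by blast
  note A = bspec[OF A] and B = bspec[OF B]
  show "\<exists>U V \<phi> \<psi>. p \<in> U \<and> U \<subseteq> D \<and> smooth_diffeo V U \<phi> \<psi> \<and>
           natural_principal_params (z \<circ> \<phi>) (l \<circ> \<phi>) V I f g (\<nu> \<circ> \<phi>)"
  proof (rule unit_principal_frame[OF assms])
    fix X Y assume sXY: "smooth_on X D" "smooth_on Y D"
      and XY: "\<And>q. q \<in> D \<Longrightarrow> mink (X q) (X q) = -1" "\<And>q. q \<in> D \<Longrightarrow> mink (Y q) (Y q) = 1"
        "\<And>q. q \<in> D \<Longrightarrow> mink (X q) (Y q) = 0"
      and zu: "\<And>q. q \<in> D \<Longrightarrow> pd_u z q = - mink (pd_u z q) (X q) *\<^sub>R X q + mink (pd_u z q) (Y q) *\<^sub>R Y q"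
      and zv: "\<And>q. q \<in> D \<Longrightarrow> pd_v z q = - mink (pd_v z q) (X q) *\<^sub>R X q + mink (pd_v z q) (Y q) *\<^sub>R Y q"
      and lu: "\<And>q. q \<in> D \<Longrightarrow> pd_u l q = (f (\<nu> q) * mink (pd_u z q) (X q)) *\<^sub>R X q
            - (g (\<nu> q) * mink (pd_u z q) (Y q)) *\<^sub>R Y q"
      and lv: "\<And>q. q \<in> D \<Longrightarrow> pd_v l q = (f (\<nu> q) * mink (pd_v z q) (X q)) *\<^sub>R X q
            - (g (\<nu> q) * mink (pd_v z q) (Y q)) *\<^sub>R Y q"
    define P Q R S where "P q = mink (pd_u z q) (X q)" and "Q q = mink (pd_v z q) (X q)"
      and "R q = mink (pd_u z q) (Y q)" and "S q = mink (pd_v z q) (Y q)" for q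
    note frame = zu[folded P_def R_def] zv[folded Q_def S_def] lu[folded P_def R_def] lv[folded Q_def S_def]
    define eA eB where "eA q = exp (A (\<nu> q))" and "eB q = exp (B (\<nu> q))" for q
    have e: "eA q > 0" "eB q > 0" for q by (simp_all add: eA_def eB_def)
    have YX: "mink (Y q) (X q) = 0" if "q \<in> D" for q using XY(3)[OF that] by (simp add: mink_commute)
    have lXY: "mink (pd_u l q) (X q) = - f (\<nu> q) * mink (pd_u z q) (X q)"
        "mink (pd_v l q) (X q) = - f (\<nu> q) * mink (pd_v z q) (X q)"
        "mink (pd_u l q) (Y q) = - g (\<nu> q) * mink (pd_u z q) (Y q)"
        "mink (pd_v l q) (Y q) = - g (\<nu> q) * mink (pd_v z q) (Y q)" if q: "q \<in> D" for q
      unfolding lu[OF q] lv[OF q] mink_lin by (simp_all add: XY[OF q] YX[OF q])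
    have closedX: "pd_v (\<lambda>x. eA x * P x) q = pd_u (\<lambda>x. eA x * Q x) q" if q: "q \<in> D" for q
      unfolding eA_def P_def Q_def
    proof (rule codazzi_closed_form[OF D q z l sXY(1) \<nu> f sA df(1) A _ XY(1)])
      \<comment> \<open>Adding the other principal curvature times \<open>dz\<close> cancels the
        \<open>Y\<close> component of \<open>dl\<close>. For the second form f and g change
        places.\<close>
      show "pd_u l q + g (\<nu> q) *\<^sub>R pd_u z q = ((f (\<nu> q) - g (\<nu> q)) * P q) *\<^sub>R X q"
        "pd_v l q + g (\<nu> q) *\<^sub>R pd_v z q = ((f (\<nu> q) - g (\<nu> q)) * Q q) *\<^sub>R X q"
        unfolding frame[OF q] by (simp_all add: algebra_simps)
    qed (use \<nu>I[OF q] fg(1)[of "\<nu> q"] lXY in auto)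
    have closedY: "pd_v (\<lambda>x. eB x * R x) q = pd_u (\<lambda>x. eB x * S x) q" if q: "q \<in> D" for q
      unfolding eB_def R_def S_def
    proof (rule codazzi_closed_form[OF D q z l sXY(2) \<nu> g sB dg(1) B _ XY(2)])
      show "pd_u l q + f (\<nu> q) *\<^sub>R pd_u z q = ((f (\<nu> q) - g (\<nu> q)) * R q) *\<^sub>R Y q"
        "pd_v l q + f (\<nu> q) *\<^sub>R pd_v z q = ((f (\<nu> q) - g (\<nu> q)) * S q) *\<^sub>R Y q"
        unfolding frame[OF q] by (simp_all add: algebra_simps)
    qed (use \<nu>I[OF q] fg(2)[of "\<nu> q"] lXY in auto)
    have sm: "smooth_on (\<lambda>q. eA q * P q) D" "smooth_on (\<lambda>q. eA q * Q q) D"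
        "smooth_on (\<lambda>q. eB q * R q) D" "smooth_on (\<lambda>q. eB q * S q) D"
      unfolding eA_def eB_def P_def Q_def R_def S_def
      by (intro smooth_on_mult smooth_on_mink smooth_on_pd z D sXY
          smooth_on_compose[OF smooth_on_exp smooth_on_compose[OF sA \<nu>]]
          smooth_on_compose[OF smooth_on_exp smooth_on_compose[OF sB \<nu>]] subset_UNIV)+
    \<comment> \<open>In the frame, \<open>E G = (R S - P Q)\<^sup>2 - (P S - Q R)\<^sup>2\<close>.
      Were the determinant zero, \<open>E G\<close> would be a square, contradicting
      \<open>E G < 0\<close>.\<close>
    have det: "eA q * P q * (eB q * S q) - eA q * Q q * (eB q * R q) \<noteq> 0" if q: "q \<in> D" for q
    proof
      assume "eA q * P q * (eB q * S q) - eA q * Q q * (eB q * R q) = 0"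
      then have "(eA q * eB q) * (P q * S q - Q q * R q) = 0" by (simp add: algebra_simps)
      then have "P q * S q - Q q * R q = 0" using e[of q] by simp
      moreover have "mink (pd_u z q) (pd_u z q) = R q * R q - P q * P q"
        "mink (pd_v z q) (pd_v z q) = S q * S q - Q q * Q q"
        unfolding frame[OF q] mink_lin by (simp_all add: XY[OF q] YX[OF q])
      ultimately have "mink (pd_u z q) (pd_u z q) * mink (pd_v z q) (pd_v z q) = (R q * S q - P q * Q q)\<^sup>2"
        by algebra
      then show False using mult_neg_pos[OF EG[OF q]] by (simp add: not_less[symmetric])
    qed
    obtain a b c d where box: "p \<in> {a<..<b} \<times> {c<..<d}" "{a..b} \<times> {c..d} \<subseteq> D"
      using open_contains_rectangle[OF D p] by metis
    \<comment> \<open>The closed rectangle lies in \<open>D\<close>, so the integrals can start on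
      its boundary; the potentials are differentiated in its interior.\<close>
    define U where "U = {a<..<b} \<times> {c<..<d}"
    have U: "open U" "p \<in> U" "U \<subseteq> D"
      using box by (auto simp: U_def intro!: open_Times)
    from closed_form_potential[OF sm(1,2) D box(2) closedX] obtain \<psi>1 where
      \<psi>1: "\<forall>q\<in>U. (\<psi>1 has_derivative (\<lambda>w. fst w * (eA q * P q) + snd w * (eA q * Q q))) (at q)"
      unfolding U_def by blast
    from closed_form_potential[OF sm(3,4) D box(2) closedY] obtain \<psi>2 where
      \<psi>2: "\<forall>q\<in>U. (\<psi>2 has_derivative (\<lambda>w. fst w * (eB q * R q) + snd w * (eB q * S q))) (at q)"
      unfolding U_def by blast
    define \<Delta> where "\<Delta> q = eA q * P q * (eB q * S q) - eA q * Q q * (eB q * R q)" for q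
    from plane_coordinates[OF U(1,2) bspec[OF \<psi>1] bspec[OF \<psi>2] sm[THEN smooth_on_subset[OF _ U(3)]]
        det[OF subsetD[OF U(3)]], folded \<Delta>_def]
    obtain U' V \<phi> where U': "p \<in> U'" "U' \<subseteq> U" "smooth_diffeo V U' \<phi> (\<lambda>q. (\<psi>1 q, \<psi>2 q))"
      and "\<forall>y\<in>V. (\<phi> has_derivative (\<lambda>w.
         ((fst w * (eB (\<phi> y) * S (\<phi> y)) - snd w * (eA (\<phi> y) * Q (\<phi> y))) / \<Delta> (\<phi> y),
          (snd w * (eA (\<phi> y) * P (\<phi> y)) - fst w * (eB (\<phi> y) * R (\<phi> y))) / \<Delta> (\<phi> y)))) (at y)"
      by blast
    note \<phi> = bspec[OF this(4)]
    have V: "open V" "smooth_on \<phi> V" "\<phi> ` V \<subseteq> D"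
      using U' U(3) by (auto simp: smooth_diffeo_def homeomorphism_def)
    have "natural_principal_params (z \<circ> \<phi>) (l \<circ> \<phi>) V I f g (\<nu> \<circ> \<phi>)"
    proof (rule natural_principal_paramsI[OF V(1) _ _ _ _ I f g _ A B])
      show "smooth_on (z \<circ> \<phi>) V" "smooth_on (l \<circ> \<phi>) V" "smooth_on (\<nu> \<circ> \<phi>) V"
        by (intro smooth_on_compose_o[OF _ V(2,3)] z l \<nu>)+
      show "(\<nu> \<circ> \<phi>) ` V \<subseteq> I" using \<nu>(2) V(3) by auto
      show "f t - g t \<noteq> 0 \<and> deriv_within f I t * deriv_within g I t \<noteq> 0" if "t \<in> I" for t
        using fg[OF that] by blast
    next
      fix y assume y: "y \<in> V"
      define q where "q = \<phi> y"
      have q: "q \<in> D" using V(3) y by (auto simp: q_def)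
      note \<phi>' = \<phi>[OF y, folded q_def]
      note dz = pd_compose_plane[where \<phi> = \<phi> and y = y, folded q_def, OF z D q \<phi>']
        and dl = pd_compose_plane[where \<phi> = \<phi> and y = y, folded q_def, OF l D q \<phi>']
      have nz: "eA q \<noteq> 0" "eB q \<noteq> 0" "\<Delta> q \<noteq> 0" using e[of q] det[OF q] by (simp_all add: \<Delta>_def)
      have "pd_u z q = (-1 * P q) *\<^sub>R X q + (1 * R q) *\<^sub>R Y q" "pd_v z q = (-1 * Q q) *\<^sub>R X q + (1 * S q) *\<^sub>R Y q"
        using frame(1,2)[OF q] by simp_all
      note Z = dz[unfolded dual_frame[OF this nz(1,2) \<Delta>_def nz(3)]]
      \<comment> \<open>In the new coordinates \<open>z\<^sub>u\<close> and \<open>l\<^sub>u\<close>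
        become \<open>- 1 / eA\<close> and \<open>f / eA\<close> times \<open>X\<close>, and
        similarly for v and \<open>Y\<close>, so \<gamma> is visibly diagonal.\<close>
      have "pd_u l q = (f (\<nu> q) * P q) *\<^sub>R X q + (- g (\<nu> q) * R q) *\<^sub>R Y q"
        "pd_v l q = (f (\<nu> q) * Q q) *\<^sub>R X q + (- g (\<nu> q) * S q) *\<^sub>R Y q"
        using frame(3,4)[OF q] by simp_all
      note L = dl[unfolded dual_frame[OF this nz(1,2) \<Delta>_def nz(3)]]
      show "mink ((l \<circ> \<phi>) y) ((l \<circ> \<phi>) y) = 1" using ll(1)[OF q] by (simp add: q_def)
      show "mink ((l \<circ> \<phi>) y) (pd_u (z \<circ> \<phi>) y) = 0" "mink ((l \<circ> \<phi>) y) (pd_v (z \<circ> \<phi>) y) = 0"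
        unfolding dz mink_lin using ll(2,3)[OF q] by (simp_all add: q_def)
      have eq: "exp (- A ((\<nu> \<circ> \<phi>) y)) = 1 / eA q" "exp (- B ((\<nu> \<circ> \<phi>) y)) = 1 / eB q"
        by (simp_all add: eA_def eB_def q_def exp_minus field_simps)
      show "mink (pd_u (z \<circ> \<phi>) y) (pd_u (z \<circ> \<phi>) y) = - (exp (- A ((\<nu> \<circ> \<phi>) y)))\<^sup>2"
        "mink (pd_u (z \<circ> \<phi>) y) (pd_v (z \<circ> \<phi>) y) = 0"
        "mink (pd_v (z \<circ> \<phi>) y) (pd_v (z \<circ> \<phi>) y) = (exp (- B ((\<nu> \<circ> \<phi>) y)))\<^sup>2"
        unfolding Z eq mink_lin XY[OF q] by (simp_all add: power2_eq_square)
      show "pd_u (l \<circ> \<phi>) y = - f ((\<nu> \<circ> \<phi>) y) *\<^sub>R pd_u (z \<circ> \<phi>) y"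
        "pd_v (l \<circ> \<phi>) y = - g ((\<nu> \<circ> \<phi>) y) *\<^sub>R pd_v (z \<circ> \<phi>) y"
        unfolding Z L by (simp_all add: q_def)
    qed
    then show "\<exists>U V \<phi> \<psi>. p \<in> U \<and> U \<subseteq> D \<and> smooth_diffeo V U \<phi> \<psi> \<and>
             natural_principal_params (z \<circ> \<phi>) (l \<circ> \<phi>) V I f g (\<nu> \<circ> \<phi>)"
      using U' U(3) by blast
  qed
qed

end
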